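(* Let $f:\mathcal X\times\mathcal Y\to\mathbb R$ be a convex-concave function that is sub-bilinear with respect to $\|\cdot\|_x$ and $\|\cdot\|_y$ (that is, $l$-sub-bilinear for some $l>0$), and suppose that for some $L>0$ the stochastic gradients satisfy, for all $t$, $$\mathbb E_t\big[\|\widetilde{\boldsymbol g}_x(t)\|_{x,*}^2\big]\le L^2\big(\|\boldsymbol y_t-\boldsymbol y_1\|_{x,*}^2+1\big),\qquad \mathbb E_t\big[\|\widetilde{\boldsymbol g}_y(t)\|_{y,*}^2\big]\le L^2\big(\|\boldsymbol x_t-\boldsymbol x_1\|_{y,*}^2+1\big).$$ Run the algorithm COMIDA (described in the context) for $T$ rounds with step sizes $\eta_x,\eta_y>0$ and regularization parameters $\varrho_x=\frac{2\eta_yL^2}{\gamma_y}$, $\varrho_y=\frac{2\eta_xL^2}{\gamma_x}$, and let $(\boldsymbol x^*,\boldsymbol y^* )\in\mathcal X\times\mathcal Y$ be arbitrary adaptive comparator points (random, possibly dependent on the whole interaction history $\mathcal F_T$). Then the duality gap $G(\boldsymbol x^*,\boldsymbol y^* )=f(\overline{\boldsymbol x}_T,\boldsymbol y^* )-f(\boldsymbol x^*,\overline{\boldsymbol y}_T)$ satisfies $$\begin{aligned}\mathbb E[G(\boldsymbol x^*,\boldsymbol y^* )]\le{}&\frac{2\,\mathbb E[\mathcal D_y(\boldsymbol y^*\|\boldsymbol y_1)]}{\eta_yT}+\frac{\varrho_y}{2}\mathbb E\big[\|\boldsymbol y^*-\boldsymbol y_1\|_{x,*}^2\big]+\frac{2\,\mathbb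 E[\mathcal D_x(\boldsymbol x^*\|\boldsymbol x_1)]}{\eta_xT}+\frac{\varrho_x}{2}\mathbb E\big[\|\boldsymbol x^*-\boldsymbol x_1\|_{y,*}^2\big]\\&+L^2\Big(\frac{\eta_y}{\gamma_y}+\frac{\eta_x}{\gamma_x}\Big).\end{aligned}$$
   Context: **Setting.** $\mathcal X\subseteq\mathbb R^m$ and $\mathcal Y\subseteq\mathbb R^n$ are convex, possibly unbounded sets. $\|\cdot\|_x$ and $\|\cdot\|_y$ are norms used for the $\boldsymbol x$- and $\boldsymbol y$-variables respectively, with dual norms $\|\cdot\|_{x,*}$ and $\|\cdot\|_{y,*}$. The dual norm $\|\cdot\|_{x,*}$ is also used to measure $\boldsymbol y$-vectors and $\|\cdot\|_{y,*}$ to measure $\boldsymbol x$-vectors; the norms are understood to be such that these expressions make sense (for example Euclidean norms in the respective spaces, or $m=n$). $f$ is convex-concave: $f(\cdot,\boldsymbol y)$ is convex for each $\boldsymbol y\in\mathcal Y$ and $f(\boldsymbol x,\cdot)$ is concave for each $\boldsymbol x\in\mathcal X$. A subgradient of $h$ at $\boldsymbol x$ is a vector $\boldsymbol g$ with $h(\boldsymbol x)-h(\boldsymbol x')\le\langle\boldsymbol g,\boldsymbol x-\boldsymbol x'\rangle$ for all $\boldsymbol x'$ in the domain; $\partial h(\boldsymbol x)$ is the set of all subgradients. **Sub-bilinearity.** $f$ is $l$-sub-bilinear with respect to $\|\cdot\|_x,\|\cdot\|_y$ if for all $(\boldsymbol x,\boldsymbol y)$ the subgradients $\boldsymbol g_x\in\partial_xf(\boldsymbol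 x,\boldsymbol y)$ and $\boldsymbol g_y\in-\partial_y(-f)(\boldsymbol x,\boldsymbol y)$ satisfy $\|\boldsymbol g_x\|_{x,*}^2\le l^2(\|\boldsymbol y\|_{x,*}^2+1)$ and $\|\boldsymbol g_y\|_{y,*}^2\le l^2(\|\boldsymbol x\|_{y,*}^2+1)$. **Distance-generating functions.** $\omega_x:\mathcal X\to\mathbb R$ and $\omega_y:\mathcal Y\to\mathbb R$ are differentiable convex functions that are respectively $\gamma_x$-strongly convex w.r.t. $\|\cdot\|_x$ and $\gamma_y$-strongly convex w.r.t. $\|\cdot\|_y$, with $\gamma_x,\gamma_y>0$ ($\omega$ is $\gamma$-strongly convex w.r.t. $\|\cdot\|$ if $\omega(\boldsymbol u')-\omega(\boldsymbol u)\ge\langle\nabla\omega(\boldsymbol u),\boldsymbol u'-\boldsymbol u\rangle+\frac\gamma2\|\boldsymbol u'-\boldsymbol u\|^2$ for all $\boldsymbol u,\boldsymbol u'$). The Bregman divergences are $\mathcal D_x(\boldsymbol x\|\boldsymbol x')=\omega_x(\boldsymbol x)-\omega_x(\boldsymbol x')-\langle\nabla\omega_x(\boldsymbol x'),\boldsymbol x-\boldsymbol x'\rangle$ and likewise $\mathcal D_y$ from $\omega_y$. **Stochastic gradients.** In round $t$, given iterates $(\boldsymbol x_t,\boldsymbol y_t)$ determined by the history $\mathcal F_{t-1}$ of the first $t-1$ rounds, there are $\boldsymbol g_x(t)\in\partial_xf(\boldsymbol x_t,\boldsymbol y_t)$ and $\boldsymbol g_y(t)\in-\partial_y(-f)(\boldsymbol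 x_t,\boldsymbol y_t)$, and one observes random vectors $\widetilde{\boldsymbol g}_x(t),\widetilde{\boldsymbol g}_y(t)$ with $\mathbb E_t[\widetilde{\boldsymbol g}_x(t)]=\boldsymbol g_x(t)$ and $\mathbb E_t[\widetilde{\boldsymbol g}_y(t)]=\boldsymbol g_y(t)$, where $\mathbb E_t[\cdot]=\mathbb E[\cdot\mid\mathcal F_{t-1}]$. **Algorithm COMIDA.** From an initial point $(\boldsymbol x_1,\boldsymbol y_1)\in\mathcal X\times\mathcal Y$, with $\mathcal H_x(\boldsymbol x)=\frac12\|\boldsymbol x-\boldsymbol x_1\|_{y,*}^2$ and $\mathcal H_y(\boldsymbol y)=\frac12\|\boldsymbol y-\boldsymbol y_1\|_{x,*}^2$, for $t=1,\dots,T$: $$\boldsymbol x_{t+1}=\arg\min_{\boldsymbol x\in\mathcal X}\Big\{\langle\boldsymbol x,\widetilde{\boldsymbol g}_x(t)\rangle+\varrho_x\mathcal H_x(\boldsymbol x)+\tfrac1{\eta_x}\mathcal D_x(\boldsymbol x\|\boldsymbol x_t)\Big\},$$ $$\boldsymbol y_{t+1}=\arg\max_{\boldsymbol y\in\mathcal Y}\Big\{\langle\boldsymbol y,\widetilde{\boldsymbol g}_y(t)\rangle-\varrho_y\mathcal H_y(\boldsymbol y)-\tfrac1{\eta_y}\mathcal D_y(\boldsymbol y\|\boldsymbol y_t)\Big\}.$$ Output: $\overline{\boldsymbol x}_T=\frac1T\sum_{t=1}^T\boldsymbol x_t$, $\overline{\boldsymbol y}_T=\frac1T\sum_{t=1}^T\boldsymbol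 y_t$. *)

theory Defs
  imports "HOL-Probability.Probability"
begin

definition is_norm :: "('a::real_vector \<Rightarrow> real) \<Rightarrow> bool" where
  "is_norm N \<longleftrightarrow>
     (\<forall>v. N v = 0 \<longleftrightarrow> v = 0) \<and>
     (\<forall>a v. N (a *\<^sub>R v) = \<bar>a\<bar> * N v) \<and>
     (\<forall>v w. N (v + w) \<le> N v + N w)"

definition dual_norm :: "('a::real_inner \<Rightarrow> real) \<Rightarrow> 'a \<Rightarrow> real" where
  "dual_norm N g = (SUP v\<in>{v. N v \<le> 1}. g \<bullet> v)"

text \<open>Subgradients are taken relative to the domain \<open>S\<close> of \<open>h\<close>: only points of \<open>S\<close> are tested.\<close>

definition subdifferential :: "'a::real_inner set \<Rightarrow> ('a \<Rightarrow> real) \<Rightarrow> 'a \<Rightarrow> 'a set" where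
  "subdifferential S h x = {g. \<forall>x'\<in>S. h x - h x' \<le> g \<bullet> (x - x')}"

definition convex_concave ::
  "'a::real_vector set \<Rightarrow> 'b::real_vector set \<Rightarrow> ('a \<Rightarrow> 'b \<Rightarrow> real) \<Rightarrow> bool" where
  "convex_concave X Y f \<longleftrightarrow>
     (\<forall>y\<in>Y. convex_on X (\<lambda>x. f x y)) \<and> (\<forall>x\<in>X. concave_on Y (\<lambda>y. f x y))"

definition partial_x ::
  "'a::real_inner set \<Rightarrow> ('a \<Rightarrow> 'b \<Rightarrow> real) \<Rightarrow> 'a \<Rightarrow> 'b \<Rightarrow> 'a set" where
  "partial_x X f x y = subdifferential X (\<lambda>x'. f x' y) x"

text \<open>The set \<open>- \<partial>\<^sub>y (- f)(x, y)\<close> of supergradients in the second variable.\<close>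

definition partial_y ::
  "'b::real_inner set \<Rightarrow> ('a \<Rightarrow> 'b \<Rightarrow> real) \<Rightarrow> 'a \<Rightarrow> 'b \<Rightarrow> 'b set" where
  "partial_y Y f x y = uminus ` subdifferential Y (\<lambda>y'. - f x y') y"

text \<open>
  The dual norms of the \<open>x\<close>-norm and of the \<open>y\<close>-norm are each applied to vectors of both spaces.
  Hence the \<open>x\<close>-norm is given by a norm \<open>nx_X\<close> on the space of \<open>x\<close>-vectors together with a norm
  \<open>nx_Y\<close> on the space of \<open>y\<close>-vectors, and likewise for \<open>ny_X\<close>, \<open>ny_Y\<close>. If both spaces
  coincide, \<open>nx_X = nx_Y\<close> and \<open>ny_X = ny_Y\<close> is a possible choice; in spaces of different
  dimension, all four may be Euclidean.
\<close>

definition sub_bilinear ::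
  "('a::real_inner \<Rightarrow> real) \<Rightarrow> ('b::real_inner \<Rightarrow> real) \<Rightarrow> ('a \<Rightarrow> real) \<Rightarrow> ('b \<Rightarrow> real) \<Rightarrow>
   'a set \<Rightarrow> 'b set \<Rightarrow> real \<Rightarrow> ('a \<Rightarrow> 'b \<Rightarrow> real) \<Rightarrow> bool" where
  "sub_bilinear nx_X nx_Y ny_X ny_Y X Y l f \<longleftrightarrow>
     (\<forall>x\<in>X. \<forall>y\<in>Y.
        (\<forall>g\<in>partial_x X f x y. (dual_norm nx_X g)\<^sup>2 \<le> l\<^sup>2 * ((dual_norm nx_Y y)\<^sup>2 + 1)) \<and>
        (\<forall>g\<in>partial_y Y f x y. (dual_norm ny_Y g)\<^sup>2 \<le> l\<^sup>2 * ((dual_norm ny_X x)\<^sup>2 + 1)))"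

text \<open>
  The gradient of \<open>\<omega>\<close> on \<open>S\<close> is a map \<open>d\<omega>\<close> representing the derivative of \<open>\<omega>\<close> relative to \<open>S\<close>.
  For convex \<open>S\<close> its inner products with differences \<open>u' - u\<close> of points of \<open>S\<close> are uniquely
  determined even where \<open>d\<omega> u\<close> itself is not (at boundary points, or if \<open>S\<close> has no interior).
\<close>

definition distance_generating ::
  "'a::real_inner set \<Rightarrow> ('a \<Rightarrow> real) \<Rightarrow> real \<Rightarrow> ('a \<Rightarrow> real) \<Rightarrow> ('a \<Rightarrow> 'a) \<Rightarrow> bool" where
  "distance_generating S N \<gamma> \<omega> d\<omega> \<longleftrightarrow>
     convex_on S \<omega> \<and>
     (\<forall>u\<in>S. (\<omega> has_derivative (\<lambda>h. d\<omega> u \<bullet> h)) (at u within S)) \<and>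
     (\<forall>u\<in>S. \<forall>u'\<in>S. \<omega> u' - \<omega> u \<ge> d\<omega> u \<bullet> (u' - u) + \<gamma> / 2 * (N (u' - u))\<^sup>2)"

definition bregman :: "('a::real_inner \<Rightarrow> real) \<Rightarrow> ('a \<Rightarrow> 'a) \<Rightarrow> 'a \<Rightarrow> 'a \<Rightarrow> real" where
  "bregman \<omega> d\<omega> x x' = \<omega> x - \<omega> x' - d\<omega> x' \<bullet> (x - x')"

definition regularizer :: "('a::real_inner \<Rightarrow> real) \<Rightarrow> 'a \<Rightarrow> 'a \<Rightarrow> real" where
  "regularizer N u1 u = (dual_norm N (u - u1))\<^sup>2 / 2"

definition average :: "nat \<Rightarrow> (nat \<Rightarrow> 'a::real_vector) \<Rightarrow> 'a" where
  "average T u = (1 / real T) *\<^sub>R (\<Sum>t=1..T. u t)"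

text \<open>Conditional expectation of a random vector, taken coordinatewise.\<close>

definition vec_cond_exp ::
  "'w measure \<Rightarrow> 'w measure \<Rightarrow> ('w \<Rightarrow> real ^ 'k) \<Rightarrow> 'w \<Rightarrow> real ^ 'k" where
  "vec_cond_exp M F g w = (\<chi> i. real_cond_exp M F (\<lambda>w. g w $ i) w)"

text \<open>
  Expectation with values in the extended reals, so that inequalities between expectations can be
  stated without integrability side conditions. It is the Bochner integral for integrable \<open>h\<close>. By
  the convention \<open>\<infinity> - \<infinity> = \<infinity>\<close> of \<^typ>\<open>ereal\<close>, a finite upper bound on
  it includes the integrability of the positive part of a measurable \<open>h\<close>.
\<close>

definition ext_expectation :: "'w measure \<Rightarrow> ('w \<Rightarrow> real) \<Rightarrow> ereal" where
  "ext_expectation M h =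
     enn2ereal (\<integral>\<^sup>+ w. ennreal (h w) \<partial>M) - enn2ereal (\<integral>\<^sup>+ w. ennreal (- h w) \<partial>M)"

end

theory Submission
  imports Defs
begin

text \<open>
  Convexity bounds the duality gap by the linearized regrets of the two players with respect to the
  true gradients. Against the observed gradients, each regret is controlled by the usual
  mirror-descent argument; the regularizers contribute negative terms \<open>- \<rho> * H\<close> of the iterates,
  which for the stated \<open>\<rho>\<close> cancel exactly the growth of the second moments of the other player's
  gradients. Since the comparator depends on the history, the difference between true and observed
  gradients does not average out; it is paid for by a second Bregman divergence through a ghost
  mirror-descent argument, phrased with the convex conjugate of the Bregman divergence.
  The second-moment bound only controls gradients relative to the iterates, so square integrability
  of iterates and gradients is established by a joint induction over the rounds.
  The duality gap itself may fail to be measurable, which is harmless because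
  \<open>ext_expectation\<close> is monotone for arbitrary functions.
\<close>

section \<open>Norms and Bregman divergences\<close>

text \<open>The factor \<open>2\<close> before each divergence and the coefficient
  \<open>\<eta> / \<gamma>\<close> have the same origin: the regret against the observed gradients
  and the correction for the noise each cost one divergence \<open>D / \<eta>\<close> and, per
  round, one term \<open>\<eta> / (2 * \<gamma>) * (dual_norm N g)\<^sup>2\<close>. The
  second-moment bound turns the coefficient into \<open>\<eta> / \<gamma> * L\<^sup>2\<close>, which
  is half of the other player's \<open>\<rho>\<close>; what survives of the gradient moments is the
  \<open>+ 1\<close> in that bound, as the last summand of the theorem. A conjugate stands in for
  ghost iterates because the domains need not be closed, so that the ghost minimizers might not
  exist. Its gradient is defined everywhere and Lipschitz, which yields measurability and square
  integrability of the predictable multipliers whose pairing with the noise must have mean zero.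
  These pairings have to be integrable in the first place, hence the moment estimates before any
  regret is averaged.\<close>

lemma is_normD:
  assumes "is_norm N"
  shows is_norm_zero_iff: "N v = 0 \<longleftrightarrow> v = 0"
    and is_norm_scaleR: "N (a *\<^sub>R v) = \<bar>a\<bar> * N v"
    and is_norm_triangle: "N (v + w) \<le> N v + N w"
  using assms unfolding is_norm_def by auto

lemma is_norm_minus: "is_norm N \<Longrightarrow> N (- v) = N v"
  using is_norm_scaleR[of N "-1" v] by simp

lemma is_norm_minus_commute: "is_norm N \<Longrightarrow> N (v - w) = N (w - v)"
  using is_norm_minus[of N "v - w"] by simp

lemma is_norm_nonneg:
  assumes "is_norm N"
  shows "0 \<le> N v"
proof -
  have "N (v + - v) \<le> N v + N (- v)"
    using assms by (rule is_norm_triangle)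
  then show ?thesis
    using is_norm_minus[OF assms, of v] is_norm_zero_iff[OF assms, of 0] by simp
qed

lemma is_norm_diff_bound:
  assumes "is_norm N"
  shows "\<bar>N v - N w\<bar> \<le> N (v - w)"
  using is_norm_triangle[OF assms, of "v - w" w] is_norm_triangle[OF assms, of "w - v" v]
    is_norm_minus_commute[OF assms, of v w] by simp

lemma is_norm_le_norm:
  fixes N :: "'a::euclidean_space \<Rightarrow> real"
  assumes N: "is_norm N"
  obtains C where "C > 0" "\<And>v. N v \<le> C * norm v"
proof
  let ?C = "(\<Sum>b\<in>Basis. N b) + 1"
  have Npos: "(\<Sum>b\<in>Basis. N b) \<ge> 0"
    by (intro sum_nonneg is_norm_nonneg N)
  then show "?C > 0" by simp
  fix v :: 'a
  have fin: "N (\<Sum>b\<in>B. h b) \<le> (\<Sum>b\<in>B. N (h b))" if "finite B" for B :: "'a set" and h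
    using that
  proof (induction B)
    case empty
    then show ?case using is_norm_zero_iff[OF N, of 0] by simp
  next
    case (insert b B)
    then show ?case using is_norm_triangle[OF N, of "h b" "sum h B"] by simp
  qed
  have "N v = N (\<Sum>b\<in>Basis. (v \<bullet> b) *\<^sub>R b)"
    by (simp add: euclidean_representation)
  also have "\<dots> \<le> (\<Sum>b\<in>Basis. \<bar>v \<bullet> b\<bar> * N b)"
    using fin[OF finite_Basis, of "\<lambda>b. (v \<bullet> b) *\<^sub>R b"] by (simp add: is_norm_scaleR[OF N])
  also have "\<dots> \<le> (\<Sum>b\<in>Basis. norm v * N b)"
    by (intro sum_mono mult_right_mono Basis_le_norm is_norm_nonneg N)
  also have "\<dots> = norm v * (\<Sum>b\<in>Basis. N b)"
    by (simp add: sum_distrib_left)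
  also have "\<dots> \<le> ?C * norm v"
    by (simp add: algebra_simps)
  finally show "N v \<le> ?C * norm v" .
qed

lemma is_norm_continuous_on:
  fixes N :: "'a::euclidean_space \<Rightarrow> real"
  assumes N: "is_norm N"
  shows "continuous_on S N"
proof -
  obtain C where C: "C > 0" "\<And>v. N v \<le> C * norm v"
    using is_norm_le_norm[OF N] by blast
  have "C-lipschitz_on S N"
  proof (rule lipschitz_onI)
    show "dist (N v) (N w) \<le> C * dist v w" for v w
      using is_norm_diff_bound[OF N, of v w] C(2)[of "v - w"] by (simp add: dist_norm)
  qed (use C in simp)
  then show ?thesis by (rule lipschitz_on_continuous_on)
qed

text \<open>The continuous function \<open>N\<close> attains its minimum on the compact unit sphere,
  and definiteness makes it positive. Together with \<open>is_norm_le_norm\<close> this is the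
  equivalence of norms, which later lets integrability be tested with the Euclidean norm.\<close>

lemma norm_le_is_norm:
  fixes N :: "'a::euclidean_space \<Rightarrow> real"
  assumes N: "is_norm N"
  obtains c where "c > 0" "\<And>v. c * norm v \<le> N v"
proof -
  obtain b :: 'a where b: "b \<in> Basis"
    using nonempty_Basis by blast
  have "\<exists>u\<in>sphere 0 1. \<forall>v\<in>sphere (0::'a) 1. N u \<le> N v"
    using b by (intro continuous_attains_inf is_norm_continuous_on N) auto
  then obtain u where u: "norm u = 1" "\<And>v. norm v = 1 \<Longrightarrow> N u \<le> N v"
    by auto
  show ?thesis
  proof
    show "N u > 0"
      using u(1) is_norm_nonneg[OF N, of u] is_norm_zero_iff[OF N, of u] by fastforce
    show "N u * norm v \<le> N v" for v
    proof (cases "v = 0")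
      case False
      have "N v = norm v * N ((1 / norm v) *\<^sub>R v)"
        using False by (simp add: is_norm_scaleR[OF N])
      then show ?thesis
        using u(2)[of "(1 / norm v) *\<^sub>R v"] False by (simp add: mult.commute)
    qed (use is_norm_zero_iff[OF N, of 0] in simp)
  qed
qed

text \<open>A real supremum is meaningful only over a set bounded above; finite dimension enters
  \<open>dual_norm\<close> here.\<close>

lemma bdd_above_dual_norm:
  fixes N :: "'a::euclidean_space \<Rightarrow> real"
  assumes N: "is_norm N"
  shows "bdd_above ((\<lambda>v. g \<bullet> v) ` {v. N v \<le> 1})"
proof -
  obtain c where c: "c > 0" "\<And>v. c * norm v \<le> N v"
    using norm_le_is_norm[OF N] by blast
  have "g \<bullet> v \<le> norm g * (1 / c)" if "N v \<le> 1" for v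
  proof -
    have "norm v \<le> 1 / c"
      using c(2)[of v] that c(1) by (simp add: field_simps)
    then show ?thesis
      using norm_cauchy_schwarz[of g v] mult_left_mono[of "norm v" "1 / c" "norm g"] by simp
  qed
  then show ?thesis
    by (auto intro!: bdd_aboveI)
qed

lemma dual_norm_upper:
  fixes N :: "'a::euclidean_space \<Rightarrow> real"
  assumes "is_norm N" "N v \<le> 1"
  shows "g \<bullet> v \<le> dual_norm N g"
  unfolding dual_norm_def using assms by (intro cSUP_upper bdd_above_dual_norm) auto

lemma dual_norm_least:
  fixes N :: "'a::euclidean_space \<Rightarrow> real"
  assumes "is_norm N" "\<And>v. N v \<le> 1 \<Longrightarrow> g \<bullet> v \<le> B"
  shows "dual_norm N g \<le> B"
  unfolding dual_norm_def using assms is_norm_zero_iff[of N 0]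
  by (intro cSUP_least) (auto intro!: exI[of _ 0])

lemma inner_le_dual_norm:
  fixes N :: "'a::euclidean_space \<Rightarrow> real"
  assumes N: "is_norm N"
  shows "g \<bullet> v \<le> dual_norm N g * N v"
proof (cases "v = 0")
  case False
  then have pos: "N v > 0"
    using is_norm_nonneg[OF N, of v] is_norm_zero_iff[OF N, of v] by simp
  then have "g \<bullet> ((1 / N v) *\<^sub>R v) \<le> dual_norm N g"
    by (intro dual_norm_upper N) (simp add: is_norm_scaleR[OF N])
  then show ?thesis
    using pos by (simp add: field_simps)
qed (use is_norm_zero_iff[OF N, of 0] in simp)

text \<open>Dual norms appear in the regularizers and in all moment bounds, so they must obey the
  same rules as \<open>N\<close>. For homogeneity, the sign of the scalar is moved into the test
  vector, and the reverse inequality is the same bound applied to the inverse scalar.\<close>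

lemma is_norm_dual_norm:
  fixes N :: "'a::euclidean_space \<Rightarrow> real"
  assumes N: "is_norm N"
  shows "is_norm (dual_norm N)"
proof -
  have nonneg: "0 \<le> dual_norm N g" for g
    using dual_norm_upper[OF N, of 0 g] is_norm_zero_iff[OF N, of 0] by simp
  have zero: "dual_norm N 0 = 0"
    using nonneg[of 0] dual_norm_least[OF N, of 0 0] by simp
  have scale_le: "dual_norm N (a *\<^sub>R g) \<le> \<bar>a\<bar> * dual_norm N g" for a g
  proof (rule dual_norm_least[OF N])
    fix v assume v: "N v \<le> 1"
    have "(a *\<^sub>R g) \<bullet> v = \<bar>a\<bar> * (g \<bullet> (sgn a *\<^sub>R v))"
      by (cases "0 \<le> a") (auto simp: sgn_if)
    also have "\<dots> \<le> \<bar>a\<bar> * dual_norm N g"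
      using v is_norm_nonneg[OF N, of v]
      by (intro mult_left_mono dual_norm_upper N) (auto simp: is_norm_scaleR[OF N] sgn_if)
    finally show "(a *\<^sub>R g) \<bullet> v \<le> \<bar>a\<bar> * dual_norm N g" .
  qed
  have scale: "dual_norm N (a *\<^sub>R g) = \<bar>a\<bar> * dual_norm N g" for a g
  proof (cases "a = 0")
    case False
    have "\<bar>a\<bar> * dual_norm N g = \<bar>a\<bar> * dual_norm N (inverse a *\<^sub>R a *\<^sub>R g)"
      using False by simp
    also have "\<dots> \<le> dual_norm N (a *\<^sub>R g)"
      using mult_left_mono[OF scale_le[of "inverse a" "a *\<^sub>R g"], of "\<bar>a\<bar>"] False
      by (simp add: field_simps abs_mult[symmetric])
    finally show ?thesis using scale_le[of a g] by simp
  qed (simp add: zero)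
  have "g = 0" if "dual_norm N g = 0" for g
    using inner_le_dual_norm[OF N, of g g] that inner_gt_zero_iff[of g] by (metis mult_zero_left not_le)
  moreover have "dual_norm N (g + h) \<le> dual_norm N g + dual_norm N h" for g h
    by (rule dual_norm_least[OF N]) (simp add: inner_add_left add_mono dual_norm_upper[OF N])
  ultimately show ?thesis
    unfolding is_norm_def using zero scale by blast
qed

text \<open>Young's inequality by completing a square. The constant is kept free; with
  \<open>c = \<gamma> / (2 * \<eta>)\<close> the first term is absorbed by a Bregman divergence over
  \<open>\<eta>\<close> and the second has coefficient
  \<open>\<eta> / (2 * \<gamma>)\<close>.\<close>

lemma inner_le_dual_norm_square:
  fixes N :: "'a::euclidean_space \<Rightarrow> real"
  assumes N: "is_norm N" and c: "c > 0"
  shows "g \<bullet> v \<le> c * (N v)\<^sup>2 + (dual_norm N g)\<^sup>2 / (4 * c)"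
proof -
  have "0 \<le> (2 * c * N v - dual_norm N g)\<^sup>2 / (4 * c)"
    using c by simp
  also have "\<dots> = c * (N v)\<^sup>2 + (dual_norm N g)\<^sup>2 / (4 * c) - dual_norm N g * N v"
    using c by (simp add: power2_eq_square field_simps)
  finally show ?thesis
    using inner_le_dual_norm[OF N, of g v] by simp
qed

lemma convex_on_regularizer:
  fixes N :: "'a::euclidean_space \<Rightarrow> real"
  assumes N: "is_norm N" and S: "convex S"
  shows "convex_on S (regularizer N u1)"
proof (rule convex_onI[OF _ S])
  fix t :: real and a b assume t: "0 < t" "t < 1"
  let ?D = "dual_norm N"
  have D: "is_norm ?D" by (rule is_norm_dual_norm[OF N])
  have "?D ((1 - t) *\<^sub>R a + t *\<^sub>R b - u1) = ?D ((1 - t) *\<^sub>R (a - u1) + t *\<^sub>R (b - u1))"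
    by (rule arg_cong[of _ _ ?D]) (simp add: algebra_simps)
  also have "\<dots> \<le> (1 - t) * ?D (a - u1) + t * ?D (b - u1)"
    using is_norm_triangle[OF D, of "(1 - t) *\<^sub>R (a - u1)" "t *\<^sub>R (b - u1)"] t
    by (simp add: is_norm_scaleR[OF D])
  finally have "(?D ((1 - t) *\<^sub>R a + t *\<^sub>R b - u1))\<^sup>2 \<le> ((1 - t) * ?D (a - u1) + t * ?D (b - u1))\<^sup>2"
    by (intro power_mono is_norm_nonneg D)
  \<comment> \<open>Convexity of the square as an identity: the defect is a nonnegative variance
    term, dropped next.\<close>
  also have "\<dots> = (1 - t) * (?D (a - u1))\<^sup>2 + t * (?D (b - u1))\<^sup>2
      - t * (1 - t) * (?D (a - u1) - ?D (b - u1))\<^sup>2"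
    by (simp add: power2_eq_square algebra_simps)
  also have "\<dots> \<le> (1 - t) * (?D (a - u1))\<^sup>2 + t * (?D (b - u1))\<^sup>2"
    using t by simp
  finally show "regularizer N u1 ((1 - t) *\<^sub>R a + t *\<^sub>R b)
      \<le> (1 - t) * regularizer N u1 a + t * regularizer N u1 b"
    unfolding regularizer_def by (simp add: field_simps)
qed

section \<open>Bregman divergences and the proximal step\<close>

lemma bregman_ge:
  assumes "distance_generating S N \<gamma> \<omega> d\<omega>" "u \<in> S" "v \<in> S"
  shows "\<gamma> / 2 * (N (u - v))\<^sup>2 \<le> bregman \<omega> d\<omega> u v"
proof -
  have "\<omega> u - \<omega> v \<ge> d\<omega> v \<bullet> (u - v) + \<gamma> / 2 * (N (u - v))\<^sup>2"
    using assms unfolding distance_generating_def by blast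
  then show ?thesis unfolding bregman_def by linarith
qed

text \<open>The first-order optimality condition in the direction of \<open>u\<close>, combined with the
  three-point identity of the Bregman divergence; \<open>H\<close> need not be differentiable.\<close>

lemma bregman_prox_inequality:
  fixes S :: "'a::real_inner set"
  assumes S: "convex S" and \<omega>: "distance_generating S N \<gamma> \<omega> d\<omega>" and \<eta>: "\<eta> > 0"
    and H: "convex_on S H" and u: "u \<in> S"
    and min: "is_arg_min (\<lambda>v. v \<bullet> g + H v + 1 / \<eta> * bregman \<omega> d\<omega> v z) (\<lambda>v. v \<in> S) z'"
  shows "g \<bullet> (z' - u) \<le> H u - H z'
    + (bregman \<omega> d\<omega> u z - bregman \<omega> d\<omega> u z' - bregman \<omega> d\<omega> z' z) / \<eta>"
proof -
  have z': "z' \<in> S"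
    and le: "\<And>v. v \<in> S \<Longrightarrow> z' \<bullet> g + H z' + 1 / \<eta> * bregman \<omega> d\<omega> z' z
      \<le> v \<bullet> g + H v + 1 / \<eta> * bregman \<omega> d\<omega> v z"
    using min unfolding is_arg_min_def by (auto simp: not_less)
  let ?d = "u - z'"
  \<comment> \<open>The minimizer may lie on the boundary of \<open>S\<close>, so only a one-sided
    derivative is available, along the segment from \<open>z'\<close> to \<open>u\<close> inside
    \<open>S\<close>.\<close>
  let ?\<phi> = "\<lambda>s::real. z' + s *\<^sub>R ?d"
  have in_S: "?\<phi> s \<in> S" if "s \<in> {0..1}" for s
    using convexD_alt[OF S z' u, of s] that by (simp add: algebra_simps)
  have "(\<omega> has_derivative (\<lambda>h. d\<omega> z' \<bullet> h)) (at (?\<phi> 0) within S)"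
    using \<omega> z' unfolding distance_generating_def by simp
  then have "(\<omega> has_derivative (\<lambda>h. d\<omega> z' \<bullet> h)) (at (?\<phi> 0) within ?\<phi> ` {0..1})"
    by (rule has_derivative_subset) (use in_S in auto)
  moreover have "(?\<phi> has_derivative (\<lambda>s. s *\<^sub>R ?d)) (at 0 within {0..1})"
    by (auto intro!: derivative_eq_intros)
  ultimately have "((\<lambda>s. \<omega> (?\<phi> s)) has_derivative (\<lambda>s. d\<omega> z' \<bullet> (s *\<^sub>R ?d))) (at 0 within {0..1})"
    by (rule has_derivative_in_compose[rotated])
  then have "((\<lambda>s. \<omega> (?\<phi> s)) has_real_derivative (d\<omega> z' \<bullet> ?d)) (at 0 within {0..1})"
    by (simp add: has_field_derivative_def mult_commute_abs)
  then have "((\<lambda>s. (\<omega> (?\<phi> s) - \<omega> z') / s) \<longlongrightarrow> d\<omega> z' \<bullet> ?d) (at_right 0)"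
    by (simp add: has_field_derivative_iff at_within_Icc_at_right)
  then have "((\<lambda>s. g \<bullet> ?d + H u - H z' + ((\<omega> (?\<phi> s) - \<omega> z') / s - d\<omega> z \<bullet> ?d) / \<eta>)
      \<longlongrightarrow> g \<bullet> ?d + H u - H z' + (d\<omega> z' \<bullet> ?d - d\<omega> z \<bullet> ?d) / \<eta>) (at_right 0)"
    using \<eta> by (intro tendsto_intros) auto
  moreover have "\<forall>\<^sub>F s in at_right 0.
      0 \<le> g \<bullet> ?d + H u - H z' + ((\<omega> (?\<phi> s) - \<omega> z') / s - d\<omega> z \<bullet> ?d) / \<eta>"
    using eventually_at_right_real[OF zero_less_one]
  proof eventually_elim
    case (elim s)
    then have s: "0 < s" "s \<le> 1" by auto
    \<comment> \<open>Convexity bounds the difference quotient of \<open>H\<close> by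
      \<open>H u - H z'\<close> for every \<open>s\<close>, so after division by \<open>s\<close>
      only \<omega> has to be passed to the limit.\<close>
    have "H (?\<phi> s) \<le> (1 - s) * H z' + s * H u"
      using convex_onD[OF H _ _ z' u, of s] s by (simp add: algebra_simps)
    moreover have "?\<phi> s \<bullet> g = z' \<bullet> g + s * (g \<bullet> ?d)"
      by (simp add: inner_add_left inner_commute[of g])
    moreover have "bregman \<omega> d\<omega> (?\<phi> s) z - bregman \<omega> d\<omega> z' z
        = \<omega> (?\<phi> s) - \<omega> z' - s * (d\<omega> z \<bullet> ?d)"
      unfolding bregman_def by (simp add: inner_add_right inner_diff_right algebra_simps)
    then have "1 / \<eta> * bregman \<omega> d\<omega> (?\<phi> s) z - 1 / \<eta> * bregman \<omega> d\<omega> z' z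
        = (\<omega> (?\<phi> s) - \<omega> z' - s * (d\<omega> z \<bullet> ?d)) / \<eta>"
      by (simp add: diff_divide_distrib[symmetric])
    moreover have "(1 - s) * H z' + s * H u = H z' + s * (H u - H z')"
      by (simp add: algebra_simps)
    ultimately have "0 \<le> s * (g \<bullet> ?d) + s * (H u - H z')
        + (\<omega> (?\<phi> s) - \<omega> z' - s * (d\<omega> z \<bullet> ?d)) / \<eta>"
      using le[of "?\<phi> s"] in_S[of s] s by simp
    then have "0 \<le> (s * (g \<bullet> ?d) + s * (H u - H z')
        + (\<omega> (?\<phi> s) - \<omega> z' - s * (d\<omega> z \<bullet> ?d)) / \<eta>) / s"
      using s by simp
    also have "\<dots> = g \<bullet> ?d + H u - H z' + ((\<omega> (?\<phi> s) - \<omega> z') / s - d\<omega> z \<bullet> ?d) / \<eta>"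
      using s \<eta> by (simp add: field_simps)
    finally show ?case .
  qed
  ultimately have "0 \<le> g \<bullet> ?d + H u - H z' + (d\<omega> z' \<bullet> ?d - d\<omega> z \<bullet> ?d) / \<eta>"
    by (intro tendsto_lowerbound) auto
  moreover have "d\<omega> z' \<bullet> ?d - d\<omega> z \<bullet> ?d
      = bregman \<omega> d\<omega> u z - bregman \<omega> d\<omega> u z' - bregman \<omega> d\<omega> z' z"
    unfolding bregman_def by (simp add: inner_diff_right)
  ultimately show ?thesis
    by (simp add: inner_diff_right)
qed

lemma bregman_prox_step:
  fixes S :: "'a::euclidean_space set"
  assumes S: "convex S" and N: "is_norm N" and \<omega>: "distance_generating S N \<gamma> \<omega> d\<omega>"
    and \<gamma>: "\<gamma> > 0" and \<eta>: "\<eta> > 0"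
    and H: "convex_on S H" and u: "u \<in> S" and z: "z \<in> S"
    and min: "is_arg_min (\<lambda>v. v \<bullet> g + H v + 1 / \<eta> * bregman \<omega> d\<omega> v z) (\<lambda>v. v \<in> S) z'"
  shows "g \<bullet> (z - u) \<le> H u - H z' + (bregman \<omega> d\<omega> u z - bregman \<omega> d\<omega> u z') / \<eta>
    + \<eta> / (2 * \<gamma>) * (dual_norm N g)\<^sup>2"
proof -
  have z': "z' \<in> S" using min unfolding is_arg_min_def by blast
  have "g \<bullet> (z - z') \<le> \<gamma> / (2 * \<eta>) * (N (z' - z))\<^sup>2 + \<eta> / (2 * \<gamma>) * (dual_norm N g)\<^sup>2"
    using inner_le_dual_norm_square[OF N, of "\<gamma> / (2 * \<eta>)" g "z - z'"] \<gamma> \<eta>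
    by (simp add: is_norm_minus_commute[OF N, of z] field_simps)
  also have "\<gamma> / (2 * \<eta>) * (N (z' - z))\<^sup>2 \<le> bregman \<omega> d\<omega> z' z / \<eta>"
    using divide_right_mono[OF bregman_ge[OF \<omega> z' z], of \<eta>] \<eta> by simp
  finally have "g \<bullet> (z - z') \<le> bregman \<omega> d\<omega> z' z / \<eta> + \<eta> / (2 * \<gamma>) * (dual_norm N g)\<^sup>2"
    by simp
  then show ?thesis
    using bregman_prox_inequality[OF S \<omega> \<eta> H u min]
    by (simp add: inner_diff_right diff_divide_distrib)
qed

text \<open>The first-order inequality at the intermediate point \<open>?m\<close>, taken towards
  both endpoints with weights \<open>1 - s\<close> and \<open>s\<close>: the gradient terms cancel,
  and the squares combine through
  \<open>(1 - s) * s\<^sup>2 + s * (1 - s)\<^sup>2 = s * (1 - s)\<close>. The divergence differs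
  from \<omega> by an affine function and so inherits the bound.\<close>

lemma bregman_strongly_convex:
  fixes S :: "'a::real_inner set"
  assumes S: "convex S" and N: "is_norm N" and \<omega>: "distance_generating S N \<gamma> \<omega> d\<omega>"
    and ab: "a \<in> S" "b \<in> S" and s: "0 \<le> s" "s \<le> 1"
  shows "bregman \<omega> d\<omega> ((1 - s) *\<^sub>R a + s *\<^sub>R b) z
    \<le> (1 - s) * bregman \<omega> d\<omega> a z + s * bregman \<omega> d\<omega> b z - \<gamma> / 2 * (s * (1 - s) * (N (a - b))\<^sup>2)"
proof -
  let ?m = "(1 - s) *\<^sub>R a + s *\<^sub>R b"
  have m: "?m \<in> S" using convexD_alt[OF S ab s] .
  have a: "a - ?m = s *\<^sub>R (a - b)" and b: "b - ?m = (1 - s) *\<^sub>R (b - a)"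
    by (simp_all add: algebra_simps)
  have "(N (a - ?m))\<^sup>2 = s\<^sup>2 * (N (a - b))\<^sup>2" "(N (b - ?m))\<^sup>2 = (1 - s)\<^sup>2 * (N (a - b))\<^sup>2"
    unfolding a b
    by (simp_all add: is_norm_scaleR[OF N] is_norm_minus_commute[OF N, of b] power_mult_distrib)
  moreover have "d\<omega> ?m \<bullet> (a - ?m) = s * (d\<omega> ?m \<bullet> (a - b))"
      "d\<omega> ?m \<bullet> (b - ?m) = - (1 - s) * (d\<omega> ?m \<bullet> (a - b))"
    unfolding a b by (simp_all add: inner_diff_right algebra_simps)
  ultimately have "s * (d\<omega> ?m \<bullet> (a - b)) + \<gamma> / 2 * (s\<^sup>2 * (N (a - b))\<^sup>2) \<le> \<omega> a - \<omega> ?m"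
      "- (1 - s) * (d\<omega> ?m \<bullet> (a - b)) + \<gamma> / 2 * ((1 - s)\<^sup>2 * (N (a - b))\<^sup>2) \<le> \<omega> b - \<omega> ?m"
    using \<omega> m ab unfolding distance_generating_def by (metis)+
  then have "(1 - s) * (s * (d\<omega> ?m \<bullet> (a - b)) + \<gamma> / 2 * (s\<^sup>2 * (N (a - b))\<^sup>2))
      + s * (- (1 - s) * (d\<omega> ?m \<bullet> (a - b)) + \<gamma> / 2 * ((1 - s)\<^sup>2 * (N (a - b))\<^sup>2))
      \<le> (1 - s) * (\<omega> a - \<omega> ?m) + s * (\<omega> b - \<omega> ?m)"
    using s by (intro add_mono mult_left_mono) auto
  moreover have "(1 - s) * (s * (d\<omega> ?m \<bullet> (a - b)) + \<gamma> / 2 * (s\<^sup>2 * (N (a - b))\<^sup>2))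
      + s * (- (1 - s) * (d\<omega> ?m \<bullet> (a - b)) + \<gamma> / 2 * ((1 - s)\<^sup>2 * (N (a - b))\<^sup>2))
      = \<gamma> / 2 * (s * (1 - s) * (N (a - b))\<^sup>2)"
    by (simp add: power2_eq_square field_simps)
  moreover have "(1 - s) * (\<omega> a - \<omega> ?m) + s * (\<omega> b - \<omega> ?m) = (1 - s) * \<omega> a + s * \<omega> b - \<omega> ?m"
    by (simp add: algebra_simps)
  ultimately have "\<omega> ?m \<le> (1 - s) * \<omega> a + s * \<omega> b - \<gamma> / 2 * (s * (1 - s) * (N (a - b))\<^sup>2)"
    by linarith
  then show ?thesis
    unfolding bregman_def by (simp add: inner_add_right inner_diff_right algebra_simps)
qed

text \<open>The supremum below need not be attained because \<open>S\<close> need not be closed, but strong convexity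
  makes every maximizing sequence converge; the limits define the gradient \<open>p\<close>.\<close>

lemma strongly_convex_conjugate:
  fixes S :: "'a::euclidean_space set"
  assumes S: "convex S" and u1: "u1 \<in> S" and N: "is_norm N" and c: "c > 0"
    and \<psi>_convex: "\<And>a b s. a \<in> S \<Longrightarrow> b \<in> S \<Longrightarrow> 0 \<le> s \<Longrightarrow> s \<le> 1 \<Longrightarrow>
      \<psi> ((1 - s) *\<^sub>R a + s *\<^sub>R b) \<le> (1 - s) * \<psi> a + s * \<psi> b - c * (s * (1 - s) * (N (a - b))\<^sup>2)"
    and \<psi>_ge: "\<And>u. u \<in> S \<Longrightarrow> c * (N (u - u1))\<^sup>2 \<le> \<psi> u" and \<psi>_u1: "\<psi> u1 = 0"
  obtains R :: "'a \<Rightarrow> real" and p :: "'a \<Rightarrow> 'a" and K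
  where "R 0 = 0"
    and "\<And>B u. u \<in> S \<Longrightarrow> - B \<bullet> (u - u1) \<le> \<psi> u + R B"
    and "\<And>C g h. R (C - h) \<le> R (C - g) + p C \<bullet> (g - h) + (dual_norm N h)\<^sup>2 / (4 * c)"
    and "K \<ge> 0" and "\<And>B C. norm (p B - p C) \<le> K * norm (B - C)"
proof -
  \<comment> \<open>\<open>R C\<close> is the convex conjugate of \<open>\<psi>\<close>, with origin
    shifted to \<open>u1\<close>, evaluated at \<open>- C\<close>. The sign makes \<open>C\<close> a
    sum of noise terms paired with \<open>u1 - u\<close>.\<close>
  define \<phi> where "\<phi> C u = - C \<bullet> (u - u1) - \<psi> u" for C u
  define R where "R C = (SUP u\<in>S. \<phi> C u)" for C
  have \<phi>_bound: "\<phi> C u \<le> (dual_norm N C)\<^sup>2 / (4 * c)" if "u \<in> S" for C u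
    using inner_le_dual_norm_square[OF N c, of "- C" "u - u1"] \<psi>_ge[OF that]
      is_norm_minus[OF is_norm_dual_norm[OF N], of C]
    unfolding \<phi>_def by simp
  have bdd: "bdd_above (\<phi> C ` S)" for C
    using \<phi>_bound by (rule bdd_aboveI2)
  have \<phi>_le: "\<phi> C u \<le> R C" if "u \<in> S" for C u
    unfolding R_def using that by (intro cSUP_upper bdd)
  have \<phi>_concave: "(1 - s) * \<phi> C a + s * \<phi> C b + c * (s * (1 - s) * (N (a - b))\<^sup>2) \<le> R C"
    if "a \<in> S" "b \<in> S" "0 \<le> s" "s \<le> 1" for C a b s
  proof -
    let ?m = "(1 - s) *\<^sub>R a + s *\<^sub>R b"
    have "?m - u1 = (1 - s) *\<^sub>R (a - u1) + s *\<^sub>R (b - u1)"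
      by (simp add: algebra_simps)
    then have "C \<bullet> (?m - u1) = (1 - s) * (C \<bullet> (a - u1)) + s * (C \<bullet> (b - u1))"
      by (simp only: inner_add_right inner_scaleR_right)
    then have "(1 - s) * \<phi> C a + s * \<phi> C b + c * (s * (1 - s) * (N (a - b))\<^sup>2) \<le> \<phi> C ?m"
      using \<psi>_convex[OF that] unfolding \<phi>_def by (simp add: algebra_simps)
    also have "\<dots> \<le> R C"
      using convexD_alt[OF S that] by (rule \<phi>_le)
    finally show ?thesis .
  qed
  have "\<exists>a. \<exists>s::nat \<Rightarrow> 'a. (\<forall>n. s n \<in> S) \<and> s \<longlonglongrightarrow> a \<and> (\<lambda>n. \<phi> C (s n)) \<longlonglongrightarrow> R C" for C
  proof -
    have "\<exists>u\<in>S. R C - 1 / Suc n < \<phi> C u" for n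
    proof -
      have "R C - 1 / Suc n < (SUP u\<in>S. \<phi> C u)"
        by (simp add: R_def)
      then show ?thesis
        using less_cSUP_iff[OF _ bdd[of C], of "R C - 1 / Suc n"] u1 by blast
    qed
    then obtain s where s: "\<And>n. s n \<in> S" "\<And>n. R C - 1 / Suc n < \<phi> C (s n)"
      by metis
    obtain c0 where c0: "c0 > 0" "\<And>v. c0 * norm v \<le> N v"
      using norm_le_is_norm[OF N] by blast
    \<comment> \<open>Both points are within \<open>1\<close> of the supremum, and strong concavity
      at their midpoint (\<open>s = 1/2\<close>, hence \<open>c / 4\<close>) forces them to be
      close. Boundedness suffices, since a convergent subsequence still maximizes.\<close>
    have "c0 * norm (s n - s 0) \<le> sqrt (4 / c)" for n
    proof -
      have "c / 4 * (N (s n - s 0))\<^sup>2 \<le> R C - (\<phi> C (s n) + \<phi> C (s 0)) / 2"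
        using \<phi>_concave[of "s n" "s 0" "1/2" C] s(1) by (simp add: field_simps)
      also have "\<dots> \<le> 1"
      proof -
        have "R C - 1 < \<phi> C (s m)" for m
        proof -
          have "1 / real (Suc m) \<le> 1" by simp
          with s(2)[of m] show ?thesis by linarith
        qed
        from this[of n] this[of 0] show ?thesis by (simp add: field_simps)
      qed
      finally have "(N (s n - s 0))\<^sup>2 \<le> 4 / c"
        using c by (simp add: field_simps)
      then show ?thesis
        using c0(2)[of "s n - s 0"] real_le_rsqrt by fastforce
    qed
    then have "norm (s n - s 0) \<le> sqrt (4 / c) / c0" for n
      using c0(1) by (simp add: field_simps)
    then have "bounded (range s)"
      by (intro boundedI[of _ "norm (s 0) + sqrt (4 / c) / c0"]) (smt (verit) imageE norm_triangle_sub)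
    then obtain a r where r: "strict_mono r" "(s \<circ> r) \<longlonglongrightarrow> a"
      using bounded_imp_convergent_subsequence by blast
    have "(\<lambda>n. \<phi> C (s n)) \<longlonglongrightarrow> R C"
    proof (rule tendsto_sandwich[where h = "\<lambda>_. R C"])
      show "(\<lambda>n. R C - 1 / Suc n) \<longlonglongrightarrow> R C"
        using tendsto_diff[OF tendsto_const LIMSEQ_inverse_real_of_nat, of "R C"]
        by (simp add: inverse_eq_divide)
    qed (auto intro!: always_eventually \<phi>_le s(1) less_imp_le[OF s(2)] simp del: of_nat_Suc)
    then have "(\<lambda>n. \<phi> C ((s \<circ> r) n)) \<longlonglongrightarrow> R C"
      using LIMSEQ_subseq_LIMSEQ[OF _ r(1)] by (fastforce simp: o_def)
    with r(2) s(1) show ?thesis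
      by (intro exI[of _ a] exI[of _ "s \<circ> r"]) auto
  qed
  then obtain A s where s: "\<And>C n. s C n \<in> S" "\<And>C. s C \<longlonglongrightarrow> A C"
      "\<And>C. (\<lambda>n. \<phi> C (s C (n::nat))) \<longlonglongrightarrow> R C"
    by metis
  have shift: "\<phi> B u = \<phi> C u - (B - C) \<bullet> (u - u1)" for B C u
    unfolding \<phi>_def by (simp add: inner_diff_left)
  \<comment> \<open>The limit \<open>A C\<close> may lie outside \<open>S\<close>, so
    \<open>\<psi>\<close> is never evaluated there; only the difference of \<open>\<phi> B\<close>
    and \<open>\<phi> C\<close>, which is linear, is passed to the limit. The result says that
    \<open>u1 - A C\<close> is a subgradient of \<open>R\<close> at \<open>C\<close>.\<close>
  have R_lower: "R B \<ge> R C - (B - C) \<bullet> (A C - u1)" for B C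
  proof (rule tendsto_upperbound)
    show "(\<lambda>n. \<phi> C (s C n) - (B - C) \<bullet> (s C n - u1)) \<longlonglongrightarrow> R C - (B - C) \<bullet> (A C - u1)"
      by (intro tendsto_intros s)
    show "\<forall>\<^sub>F n in sequentially. \<phi> C (s C n) - (B - C) \<bullet> (s C n - u1) \<le> R B"
      by (intro always_eventually allI, unfold shift[symmetric]) (rule \<phi>_le[OF s(1)])
  qed simp
  have N_tendsto: "(\<lambda>n. N (f n)) \<longlonglongrightarrow> N a" if "f \<longlonglongrightarrow> a" for f :: "nat \<Rightarrow> 'a" and a
    using is_norm_continuous_on[OF N, of UNIV] that
    by (auto intro: continuous_on_tendsto_compose)
  \<comment> \<open>Quadratic growth away from the maximizing limit: strong concavity between
    \<open>s C n\<close> and \<open>u\<close>, first \<open>n\<close> to infinity, then division by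
    \<open>t\<close> and \<open>t\<close> to zero.\<close>
  have \<phi>_growth: "\<phi> C u + c * (N (A C - u))\<^sup>2 \<le> R C" if u: "u \<in> S" for C u
  proof -
    have "\<phi> C u + c * ((1 - t) * (N (A C - u))\<^sup>2) \<le> R C" if t: "0 < t" "t < 1" for t
    proof -
      have "(1 - t) * R C + t * \<phi> C u + c * (t * (1 - t) * (N (A C - u))\<^sup>2) \<le> R C"
      proof (rule tendsto_upperbound)
        show "(\<lambda>n. (1 - t) * \<phi> C (s C n) + t * \<phi> C u + c * (t * (1 - t) * (N (s C n - u))\<^sup>2))
          \<longlonglongrightarrow> (1 - t) * R C + t * \<phi> C u + c * (t * (1 - t) * (N (A C - u))\<^sup>2)"
          by (intro tendsto_intros s N_tendsto)
      qed (use \<phi>_concave[OF s(1) u] t in auto)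
      then have "t * (\<phi> C u + c * ((1 - t) * (N (A C - u))\<^sup>2)) \<le> t * R C"
        by (simp add: algebra_simps)
      then show ?thesis using t by simp
    qed
    then have "\<forall>\<^sub>F t in at_right 0. \<phi> C u + c * ((1 - t) * (N (A C - u))\<^sup>2) \<le> R C"
      by (intro eventually_mono[OF eventually_at_right_real[OF zero_less_one]]) auto
    moreover have "((\<lambda>t. \<phi> C u + c * ((1 - t) * (N (A C - u))\<^sup>2))
        \<longlongrightarrow> \<phi> C u + c * ((1 - 0) * (N (A C - u))\<^sup>2)) (at_right 0)"
      by (intro tendsto_intros)
    ultimately show ?thesis
      by (auto dest: tendsto_upperbound)
  qed
  have R_upper: "R (C - h) \<le> R C + h \<bullet> (A C - u1) + (dual_norm N h)\<^sup>2 / (4 * c)" for C h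
    unfolding R_def[of "C - h"]
  proof (rule cSUP_least)
    show "S \<noteq> {}" using u1 by blast
    fix u assume u: "u \<in> S"
    have "\<phi> (C - h) u = \<phi> C u + h \<bullet> (u - u1)"
      using shift[of "C - h" u C] by simp
    also have "\<dots> = \<phi> C u + h \<bullet> (A C - u1) + h \<bullet> (u - A C)"
      by (simp add: inner_diff_right)
    also have "\<dots> \<le> \<phi> C u + h \<bullet> (A C - u1) + (c * (N (A C - u))\<^sup>2 + (dual_norm N h)\<^sup>2 / (4 * c))"
      using inner_le_dual_norm_square[OF N c, of h "u - A C"] is_norm_minus_commute[OF N, of u]
      by simp
    also have "\<dots> \<le> R C + h \<bullet> (A C - u1) + (dual_norm N h)\<^sup>2 / (4 * c)"
      using \<phi>_growth[OF u, of C] by simp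
    finally show "\<phi> (C - h) u \<le> R C + h \<bullet> (A C - u1) + (dual_norm N h)\<^sup>2 / (4 * c)" .
  qed
  \<comment> \<open>Growth at \<open>C\<close> tested along the maximizing sequence of
    \<open>B\<close>. Against \<open>R_lower\<close> the values of \<open>R\<close> cancel, leaving
    strong monotonicity of \<open>A\<close>, from which the Lipschitz bound follows by
    Cauchy-Schwarz.\<close>
  have A_growth: "R B + (B - C) \<bullet> (A B - u1) + c * (N (A C - A B))\<^sup>2 \<le> R C" for B C
  proof (rule tendsto_upperbound)
    show "(\<lambda>n. \<phi> B (s B n) + (B - C) \<bullet> (s B n - u1) + c * (N (A C - s B n))\<^sup>2)
      \<longlonglongrightarrow> R B + (B - C) \<bullet> (A B - u1) + c * (N (A C - A B))\<^sup>2"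
      by (intro tendsto_intros s N_tendsto)
    show "\<forall>\<^sub>F n in sequentially. \<phi> B (s B n) + (B - C) \<bullet> (s B n - u1) + c * (N (A C - s B n))\<^sup>2 \<le> R C"
      using \<phi>_growth[OF s(1), of C B] shift[of B _ C] by simp
  qed simp
  obtain c0 where c0: "c0 > 0" "\<And>v. c0 * norm v \<le> N v"
    using norm_le_is_norm[OF N] by blast
  have A_lipschitz: "norm (A B - A C) \<le> 1 / (c * c0\<^sup>2) * norm (B - C)" for B C
  proof (cases "A B = A C")
    case False
    have "c * (c0 * norm (A B - A C))\<^sup>2 \<le> c * (N (A C - A B))\<^sup>2"
      using c c0 c0(2)[of "A C - A B"]
      by (intro mult_left_mono power_mono) (auto simp: norm_minus_commute)
    also have "\<dots> \<le> (B - C) \<bullet> (A C - A B)"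
      using A_growth[of B C] R_lower[of C B] by (simp add: inner_diff_left inner_diff_right)
    also have "\<dots> \<le> norm (B - C) * norm (A B - A C)"
      by (metis norm_cauchy_schwarz norm_minus_commute)
    finally have "c * c0\<^sup>2 * norm (A B - A C) \<le> norm (B - C)"
      using False by (simp add: power2_eq_square)
    then show ?thesis
      using c c0(1) by (simp add: field_simps)
  qed (use c c0 in simp)
  show thesis
  proof
    show "R 0 = 0"
    proof (rule antisym)
      show "R 0 \<le> 0"
      proof -
        have "0 \<le> \<psi> u" if "u \<in> S" for u
          using \<psi>_ge[OF that] c by (smt (verit) mult_nonneg_nonneg zero_le_power2)
        then show ?thesis
          unfolding R_def \<phi>_def using u1 by (intro cSUP_least) auto
      qed
      show "0 \<le> R 0"
        using \<phi>_le[OF u1, of 0] \<psi>_u1 by (simp add: \<phi>_def)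
    qed
    show "- B \<bullet> (u - u1) \<le> \<psi> u + R B" if "u \<in> S" for B u
      using \<phi>_le[OF that, of B] by (simp add: \<phi>_def)
    \<comment> \<open>Smoothness bounds \<open>R (C - h)\<close> from above and convexity bounds
      \<open>R (C - g)\<close> from below, both expanded at \<open>C\<close>; only the smoothness
      side has a quadratic cost, so \<open>g\<close> contributes none.\<close>
    show "R (C - h) \<le> R (C - g) + (u1 - A C) \<bullet> (g - h) + (dual_norm N h)\<^sup>2 / (4 * c)" for C g h
      using R_upper[of C h] R_lower[of C "C - g"]
      by (simp add: inner_diff_left inner_diff_right inner_commute)
    show "norm ((u1 - A B) - (u1 - A C)) \<le> 1 / (c * c0\<^sup>2) * norm (B - C)" for B C
      using A_lipschitz[of B C] by (simp add: norm_minus_commute)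
    show "0 \<le> 1 / (c * c0\<^sup>2)" using c by simp
  qed
qed

section \<open>Integration\<close>

lemma ext_expectation_mono_AE:
  assumes "AE w in M. h w \<le> k w"
  shows "ext_expectation M h \<le> ext_expectation M k"
  unfolding ext_expectation_def less_eq_ennreal.rep_eq[symmetric]
proof (rule ereal_minus_mono)
  show "enn2ereal (\<integral>\<^sup>+ w. ennreal (h w) \<partial>M) \<le> enn2ereal (\<integral>\<^sup>+ w. ennreal (k w) \<partial>M)"
    unfolding less_eq_ennreal.rep_eq[symmetric]
    by (intro nn_integral_mono_AE eventually_mono[OF assms] ennreal_leI) auto
  show "enn2ereal (\<integral>\<^sup>+ w. ennreal (- k w) \<partial>M) \<le> enn2ereal (\<integral>\<^sup>+ w. ennreal (- h w) \<partial>M)"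
    unfolding less_eq_ennreal.rep_eq[symmetric]
    by (intro nn_integral_mono_AE eventually_mono[OF assms] ennreal_leI) auto
qed

lemma ext_expectation_eq_integral:
  assumes "integrable M h"
  shows "ext_expectation M h = ereal (\<integral> w. h w \<partial>M)"
proof -
  have "(\<integral>\<^sup>+ w. ennreal (h w) \<partial>M) < \<top>" "(\<integral>\<^sup>+ w. ennreal (- h w) \<partial>M) < \<top>"
    using assms by (auto simp: real_integrable_def less_top)
  then show ?thesis
    unfolding ext_expectation_def real_lebesgue_integral_def[OF assms]
    by (cases "\<integral>\<^sup>+ w. ennreal (h w) \<partial>M"; cases "\<integral>\<^sup>+ w. ennreal (- h w) \<partial>M") auto
qed

lemma ext_expectation_nonneg_eq:
  assumes "AE w in M. 0 \<le> h w"
  shows "ext_expectation M h = enn2ereal (\<integral>\<^sup>+ w. ennreal (h w) \<partial>M)"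
proof -
  have "(\<integral>\<^sup>+ w. ennreal (- h w) \<partial>M) = (\<integral>\<^sup>+ w. 0 \<partial>M)"
    using assms by (intro nn_integral_cong_AE) (auto simp: ennreal_neg)
  then show ?thesis unfolding ext_expectation_def by (simp add: zero_ennreal.rep_eq)
qed

text \<open>Serves the comparators with an infinite divergence or second moment, for which the
  claimed bound is infinite.\<close>

lemma ext_expectation_not_integrable:
  assumes "h \<in> borel_measurable M" "AE w in M. 0 \<le> h w" "\<not> integrable M h"
  shows "ext_expectation M h = \<infinity>"
proof -
  have "(\<integral>\<^sup>+ w. ennreal (h w) \<partial>M) = \<top>"
  proof (rule ccontr)
    assume "(\<integral>\<^sup>+ w. ennreal (h w) \<partial>M) \<noteq> \<top>"
    then have "(\<integral>\<^sup>+ w. ennreal (h w) \<partial>M) < \<infinity>"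
      by (simp add: less_top)
    then show False
      using integrableI_nonneg[OF assms(1,2)] assms(3) by simp
  qed
  then show ?thesis
    using ext_expectation_nonneg_eq[OF assms(2)] by (simp add: top_ennreal.rep_eq top_ereal_def)
qed

text \<open>The Euclidean norm is a neutral choice by equivalence of norms, and makes inner products
  of two such vectors integrable.\<close>

definition square_integrable :: "'w measure \<Rightarrow> ('w \<Rightarrow> 'a::euclidean_space) \<Rightarrow> bool" where
  "square_integrable M v \<longleftrightarrow> v \<in> borel_measurable M \<and> integrable M (\<lambda>w. (norm (v w))\<^sup>2)"

lemma square_integrable_measurable [dest]:
  "square_integrable M v \<Longrightarrow> v \<in> borel_measurable M"
  unfolding square_integrable_def by simp

lemma square_integrableI_bound:
  assumes "v \<in> borel_measurable M" "integrable M k" "AE w in M. (norm (v w))\<^sup>2 \<le> k w"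
  shows "square_integrable M v"
proof -
  have [measurable]: "v \<in> borel_measurable M" by fact
  have "integrable M (\<lambda>w. (norm (v w))\<^sup>2)"
    by (rule Bochner_Integration.integrable_bound[OF assms(2)], measurable)
      (auto intro: eventually_mono[OF assms(3)])
  with assms(1) show ?thesis unfolding square_integrable_def by blast
qed

lemma square_integrable_add:
  assumes "square_integrable M u" "square_integrable M v"
  shows "square_integrable M (\<lambda>w. u w + v w)"
proof (rule square_integrableI_bound)
  show "integrable M (\<lambda>w. 2 * (norm (u w))\<^sup>2 + 2 * (norm (v w))\<^sup>2)"
    using assms unfolding square_integrable_def by simp
  have "(norm (a + b))\<^sup>2 \<le> 2 * (norm a)\<^sup>2 + 2 * (norm b)\<^sup>2" for a b :: 'b
    using zero_le_power2[of "norm (a - b)"] by (simp add: power2_norm_eq_inner inner_add inner_diff)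
  then show "AE w in M. (norm (u w + v w))\<^sup>2 \<le> 2 * (norm (u w))\<^sup>2 + 2 * (norm (v w))\<^sup>2"
    by simp
qed (use assms in \<open>auto simp: square_integrable_def\<close>)

lemma square_integrable_minus:
  "square_integrable M v \<Longrightarrow> square_integrable M (\<lambda>w. - v w)"
  unfolding square_integrable_def by simp

lemma square_integrable_diff:
  "square_integrable M u \<Longrightarrow> square_integrable M v \<Longrightarrow> square_integrable M (\<lambda>w. u w - v w)"
  using square_integrable_add[OF _ square_integrable_minus, of M u v] by simp

lemma (in finite_measure) square_integrable_const: "square_integrable M (\<lambda>w. c)"
  unfolding square_integrable_def by simp

lemma (in finite_measure) square_integrable_sum:
  "(\<And>i. i \<in> I \<Longrightarrow> square_integrable M (v i)) \<Longrightarrow> square_integrable M (\<lambda>w. \<Sum>i\<in>I. v i w)"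
proof (induction I rule: infinite_finite_induct)
  case (insert i I)
  then show ?case by (simp add: square_integrable_add)
qed (simp_all add: square_integrable_const)

lemma square_integrable_inner:
  assumes "square_integrable M u" "square_integrable M v"
  shows "integrable M (\<lambda>w. u w \<bullet> v w)"
proof (rule Bochner_Integration.integrable_bound)
  show "integrable M (\<lambda>w. (norm (u w))\<^sup>2 + (norm (v w))\<^sup>2)"
    using assms unfolding square_integrable_def by simp
  have [measurable]: "u \<in> borel_measurable M" "v \<in> borel_measurable M"
    using assms by auto
  show "(\<lambda>w. u w \<bullet> v w) \<in> borel_measurable M"
    by measurable
  have "\<bar>a \<bullet> b\<bar> \<le> (norm a)\<^sup>2 + (norm b)\<^sup>2" for a b :: 'b
    using Cauchy_Schwarz_ineq2[of a b] sum_squares_bound[of "norm a" "norm b"]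
      mult_nonneg_nonneg[OF norm_ge_zero norm_ge_zero, of a b] by linarith
  then show "AE w in M. norm (u w \<bullet> v w) \<le> norm ((norm (u w))\<^sup>2 + (norm (v w))\<^sup>2)"
    by (simp add: abs_of_nonneg)
qed

lemma square_integrable_is_norm:
  assumes N: "is_norm N" and v: "square_integrable M v"
  shows "integrable M (\<lambda>w. (N (v w))\<^sup>2)"
proof -
  obtain C where C: "C > 0" "\<And>v. N v \<le> C * norm v"
    using is_norm_le_norm[OF N] by blast
  have [measurable]: "v \<in> borel_measurable M" "N \<in> borel_measurable borel"
    using v borel_measurable_continuous_onI[OF is_norm_continuous_on[OF N]] by auto
  show ?thesis
  proof (rule Bochner_Integration.integrable_bound)
    show "integrable M (\<lambda>w. C\<^sup>2 * (norm (v w))\<^sup>2)"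
      using v unfolding square_integrable_def by simp
    show "AE w in M. norm ((N (v w))\<^sup>2) \<le> norm (C\<^sup>2 * (norm (v w))\<^sup>2)"
      using power_mono[OF C(2) is_norm_nonneg[OF N], where n = 2] by (simp add: power_mult_distrib)
  qed measurable
qed

lemma square_integrableI_is_norm:
  assumes N: "is_norm N" and v: "v \<in> borel_measurable M" and k: "integrable M k"
    and le: "AE w in M. (N (v w))\<^sup>2 \<le> k w"
  shows "square_integrable M v"
proof -
  obtain c where c: "c > 0" "\<And>v. c * norm v \<le> N v"
    using norm_le_is_norm[OF N] by blast
  have "c\<^sup>2 * (norm a)\<^sup>2 \<le> (N a)\<^sup>2" for a
    using power_mono[OF c(2), of a 2] c(1) by (simp add: power_mult_distrib)
  then have "(norm a)\<^sup>2 \<le> (N a)\<^sup>2 / c\<^sup>2" for a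
    using c(1) by (simp add: field_simps)
  then have "(norm a)\<^sup>2 \<le> b / c\<^sup>2" if "(N a)\<^sup>2 \<le> b" for a b
    using that by (meson divide_right_mono order_trans zero_le_power2)
  then show ?thesis
    by (intro square_integrableI_bound[OF v, of "\<lambda>w. k w / c\<^sup>2"] integrable_divide_zero
        eventually_mono[OF le] impI k)
qed

text \<open>A Lipschitz map grows at most linearly, and the constant \<open>p 0\<close> is square
  integrable on a finite measure. Intended for the gradient of the conjugate along the accumulated
  noise.\<close>

lemma (in finite_measure) square_integrable_lipschitz:
  assumes v: "square_integrable M v" and K: "K \<ge> 0" "\<And>a b. norm (p a - p b) \<le> K * norm (a - b)"
  shows "square_integrable M (\<lambda>w. p (v w))"
proof (rule square_integrableI_bound)
  have "K-lipschitz_on UNIV p"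
    using K by (intro lipschitz_onI) (auto simp: dist_norm)
  then have "p \<in> borel_measurable borel"
    using borel_measurable_continuous_onI lipschitz_on_continuous_on by blast
  then show "(\<lambda>w. p (v w)) \<in> borel_measurable M"
    using measurable_compose[OF square_integrable_measurable[OF v]] by blast
  show "integrable M (\<lambda>w. 2 * K\<^sup>2 * (norm (v w))\<^sup>2 + 2 * (norm (p 0))\<^sup>2)"
    using v unfolding square_integrable_def by simp
  have "(norm (p a))\<^sup>2 \<le> 2 * K\<^sup>2 * (norm a)\<^sup>2 + 2 * (norm (p 0))\<^sup>2" for a
  proof -
    have "norm (p a) \<le> K * norm a + norm (p 0)"
      using K(2)[of a 0] norm_triangle_sub[of "p a" "p 0"] by simp
    then have "(norm (p a))\<^sup>2 \<le> (K * norm a + norm (p 0))\<^sup>2"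
      by (intro power_mono) auto
    also have "\<dots> \<le> 2 * K\<^sup>2 * (norm a)\<^sup>2 + 2 * (norm (p 0))\<^sup>2"
      using zero_le_power2[of "K * norm a - norm (p 0)"] by (simp add: power2_eq_square algebra_simps)
    finally show ?thesis .
  qed
  then show "AE w in M. (norm (p (v w)))\<^sup>2 \<le> 2 * K\<^sup>2 * (norm (v w))\<^sup>2 + 2 * (norm (p 0))\<^sup>2"
    by simp
qed

section \<open>Conditional expectations of random vectors\<close>

lemma borel_measurable_vec_cond_exp: "vec_cond_exp M F g \<in> borel_measurable F"
  by (subst borel_measurable_euclidean_space) (auto simp: vec_cond_exp_def Basis_vec_def inner_axis)

text \<open>The pull-out property in each coordinate; square integrability makes each product of
  coordinates integrable, so that the sum can be exchanged with the integral.\<close>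

lemma (in finite_measure_subalgebra) integral_inner_vec_cond_exp:
  fixes g q :: "'a \<Rightarrow> real ^ 'k"
  assumes g: "square_integrable M g" and q: "square_integrable M q" "q \<in> borel_measurable F"
  shows "(\<integral> w. q w \<bullet> vec_cond_exp M F g w \<partial>M) = (\<integral> w. q w \<bullet> g w \<partial>M)"
proof -
  have component: "square_integrable M (\<lambda>w. v w $ i)"
    if "square_integrable M v" for v :: "'a \<Rightarrow> real ^ 'k" and i
  proof (rule square_integrableI_bound)
    have [measurable]: "v \<in> borel_measurable M" using that by auto
    have "(\<lambda>w. v w \<bullet> axis i 1) \<in> borel_measurable M" by measurable
    then show "(\<lambda>w. v w $ i) \<in> borel_measurable M" by (simp add: inner_axis)
    show "integrable M (\<lambda>w. (norm (v w))\<^sup>2)"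
      using that unfolding square_integrable_def by simp
    show "AE w in M. (norm (v w $ i))\<^sup>2 \<le> (norm (v w))\<^sup>2"
      by (intro AE_I2 power_mono Finite_Cartesian_Product.norm_nth_le) auto
  qed
  have int: "integrable M (\<lambda>w. q w $ i * g w $ i)" for i
    using square_integrable_inner[OF component[OF q(1), of i] component[OF g, of i]] by simp
  have "(\<lambda>w. q w \<bullet> axis i 1) \<in> borel_measurable F" for i
    using q(2) by measurable
  then have meas: "(\<lambda>w. q w $ i) \<in> borel_measurable F" for i
    by (simp add: inner_axis)
  have g_meas: "(\<lambda>w. g w $ i) \<in> borel_measurable M" for i
    using component[OF g] by auto
  note rce = real_cond_exp_intg[OF int meas g_meas]
  show ?thesis
    unfolding inner_vec_def vec_cond_exp_def using rce int
    by (simp add: Bochner_Integration.integral_sum)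
qed

text \<open>The nonnegative conditional expectation makes sense before any integrability of
  \<open>g\<close> is known; integrating its bound is what yields that integrability.\<close>

lemma (in finite_measure_subalgebra) nn_cond_exp_square_bound:
  assumes N: "is_norm N" and g: "g \<in> borel_measurable M" and k: "integrable M k" "\<And>w. 0 \<le> k w"
    and le: "AE w in M. nn_cond_exp M F (\<lambda>w. ennreal ((N (g w))\<^sup>2)) w \<le> ennreal (k w)"
  shows "square_integrable M g" and "(\<integral> w. (N (g w))\<^sup>2 \<partial>M) \<le> (\<integral> w. k w \<partial>M)"
proof -
  have [measurable]: "N \<in> borel_measurable borel"
    using borel_measurable_continuous_onI[OF is_norm_continuous_on[OF N]] .
  note [measurable] = g
  have meas: "(\<lambda>w. (N (g w))\<^sup>2) \<in> borel_measurable M" by measurable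
  have "(\<integral>\<^sup>+ w. ennreal ((N (g w))\<^sup>2) \<partial>M)
      = (\<integral>\<^sup>+ w. nn_cond_exp M F (\<lambda>w. ennreal ((N (g w))\<^sup>2)) w \<partial>M)"
    using nn_cond_exp_intg[of "\<lambda>_. 1" "\<lambda>w. ennreal ((N (g w))\<^sup>2)"] by simp
  also have "\<dots> \<le> (\<integral>\<^sup>+ w. ennreal (k w) \<partial>M)"
    using le by (rule nn_integral_mono_AE)
  also have "\<dots> = ennreal (\<integral> w. k w \<partial>M)"
    using k by (intro nn_integral_eq_integral) auto
  finally have *: "(\<integral>\<^sup>+ w. ennreal ((N (g w))\<^sup>2) \<partial>M) \<le> ennreal (\<integral> w. k w \<partial>M)" .
  then have int: "integrable M (\<lambda>w. (N (g w))\<^sup>2)"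
    by (intro integrableI_nonneg meas) (auto intro: le_less_trans)
  then show "square_integrable M g"
    by (intro square_integrableI_is_norm[OF N g]) auto
  have "ennreal (\<integral> w. (N (g w))\<^sup>2 \<partial>M) \<le> ennreal (\<integral> w. k w \<partial>M)"
    using * nn_integral_eq_integral[OF int] by simp
  then show "(\<integral> w. (N (g w))\<^sup>2 \<partial>M) \<le> (\<integral> w. k w \<partial>M)"
    using k by (simp add: ennreal_le_iff Bochner_Integration.integral_nonneg)
qed

section \<open>Regret of one player\<close>

lemma bregman_prox_regret:
  fixes S :: "'a::euclidean_space set" and z g :: "nat \<Rightarrow> 'a"
  assumes S: "convex S" and N: "is_norm N" and \<omega>: "distance_generating S N \<gamma> \<omega> d\<omega>"
    and \<gamma>: "\<gamma> > 0" and \<eta>: "\<eta> > 0"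
    and H: "convex_on S H" "\<And>v. v \<in> S \<Longrightarrow> 0 \<le> H v" "H (z 1) = 0"
    and u: "u \<in> S" and z1: "z 1 \<in> S"
    and min: "\<And>t. t \<in> {1..n} \<Longrightarrow>
      is_arg_min (\<lambda>v. v \<bullet> g t + H v + 1 / \<eta> * bregman \<omega> d\<omega> v (z t)) (\<lambda>v. v \<in> S) (z (t + 1))"
  shows "(\<Sum>t=1..n. g t \<bullet> (z t - u)) \<le> bregman \<omega> d\<omega> u (z 1) / \<eta> + real n * H u
    - (\<Sum>t=1..n. H (z t)) + \<eta> / (2 * \<gamma>) * (\<Sum>t=1..n. (dual_norm N (g t))\<^sup>2)"
proof -
  have z: "z (t + 1) \<in> S" if "t \<le> n" for t
    using min[of t] z1 that by (cases "t = 0") (auto simp: is_arg_min_def)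
  \<comment> \<open>Each round yields \<open>- H\<close> at the next iterate, while the cancellation
    needs the indices of the gradients. The value \<open>H (z 1) = 0\<close> supplies the missing
    first term, and the surplus term at \<open>n + 1\<close> is discarded by nonnegativity at the
    end.\<close>
  have "(\<Sum>t=1..m. g t \<bullet> (z t - u)) \<le> (bregman \<omega> d\<omega> u (z 1) - bregman \<omega> d\<omega> u (z (m + 1))) / \<eta>
      + real m * H u - (\<Sum>t=1..m+1. H (z t)) + \<eta> / (2 * \<gamma>) * (\<Sum>t=1..m. (dual_norm N (g t))\<^sup>2)"
    if "m \<le> n" for m
    using that
  proof (induction m)
    case 0
    then show ?case using H(3) by simp
  next
    case (Suc m)
    have "g (Suc m) \<bullet> (z (Suc m) - u) \<le> H u - H (z (Suc m + 1))
        + (bregman \<omega> d\<omega> u (z (Suc m)) - bregman \<omega> d\<omega> u (z (Suc m + 1))) / \<eta>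
        + \<eta> / (2 * \<gamma>) * (dual_norm N (g (Suc m)))\<^sup>2"
      using Suc.prems z[of m] min[of "Suc m"]
      by (intro bregman_prox_step[OF S N \<omega> \<gamma> \<eta> H(1) u]) auto
    then show ?case
      using Suc by (simp add: algebra_simps diff_divide_distrib)
  qed
  from this[of n] have "(\<Sum>t=1..n. g t \<bullet> (z t - u))
      \<le> (bregman \<omega> d\<omega> u (z 1) - bregman \<omega> d\<omega> u (z (n + 1))) / \<eta>
      + real n * H u - (\<Sum>t=1..n+1. H (z t)) + \<eta> / (2 * \<gamma>) * (\<Sum>t=1..n. (dual_norm N (g t))\<^sup>2)"
    by simp
  moreover have "0 \<le> bregman \<omega> d\<omega> u (z (n + 1)) / \<eta>"
  proof -
    have "0 \<le> \<gamma> / 2 * (N (u - z (n + 1)))\<^sup>2"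
      using \<gamma> by simp
    also have "\<dots> \<le> bregman \<omega> d\<omega> u (z (n + 1))"
      using z[of n] by (intro bregman_ge[OF \<omega> u]) simp
    finally show ?thesis using \<eta> by simp
  qed
  moreover have "(\<Sum>t=1..n. H (z t)) \<le> (\<Sum>t=1..n+1. H (z t))"
    using H(2)[OF z[of n]] by simp
  ultimately show ?thesis
    by (simp add: diff_divide_distrib)
qed

text \<open>The proximal inequality with the current iterate as its own comparator, rescaled by
  \<open>2 / \<rho>\<close>. It is the regularizer that confines the next iterate in terms of the
  observed gradient, even on an unbounded domain.\<close>

lemma bregman_prox_step_dist:
  fixes S :: "'a::euclidean_space set"
  assumes S: "convex S" and N: "is_norm N" "is_norm N'"
    and \<omega>: "distance_generating S N \<gamma> \<omega> d\<omega>"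
    and \<gamma>: "\<gamma> > 0" and \<eta>: "\<eta> > 0" and \<rho>: "\<rho> > 0" and z: "z \<in> S"
    and min: "is_arg_min (\<lambda>v. v \<bullet> g + \<rho> * regularizer N' u1 v + 1 / \<eta> * bregman \<omega> d\<omega> v z)
      (\<lambda>v. v \<in> S) z'"
  shows "(dual_norm N' (z' - u1))\<^sup>2
    \<le> (dual_norm N' (z - u1))\<^sup>2 + \<eta> / (\<gamma> * \<rho>) * (dual_norm N g)\<^sup>2"
proof -
  let ?H = "\<lambda>v. \<rho> * regularizer N' u1 v"
  have H: "convex_on S ?H"
    using \<rho> by (intro convex_on_cmul convex_on_regularizer N S) auto
  have z': "z' \<in> S" using min unfolding is_arg_min_def by blast
  have "0 \<le> \<gamma> / 2 * (N (z - z'))\<^sup>2"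
    using \<gamma> by simp
  also have "\<dots> \<le> bregman \<omega> d\<omega> z z'"
    by (rule bregman_ge[OF \<omega> z z'])
  finally have "0 \<le> bregman \<omega> d\<omega> z z' / \<eta>"
    using \<eta> by simp
  moreover have "bregman \<omega> d\<omega> z z = 0"
    by (simp add: bregman_def)
  ultimately have "?H z' \<le> ?H z + \<eta> / (2 * \<gamma>) * (dual_norm N g)\<^sup>2"
    using bregman_prox_step[OF S N(1) \<omega> \<gamma> \<eta> H z z min] by (simp add: diff_divide_distrib)
  then have "2 / \<rho> * ?H z' \<le> 2 / \<rho> * (?H z + \<eta> / (2 * \<gamma>) * (dual_norm N g)\<^sup>2)"
    using \<rho> by (intro mult_left_mono) auto
  then show ?thesis
    using \<rho> \<gamma> unfolding regularizer_def by (simp add: distrib_left mult.commute)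
qed

text \<open>Here \<open>g\<close> is observed and \<open>g'\<close> is its conditional expectation. The comparator may depend on
  the noise \<open>\<xi> t = g' t - g t\<close>. Its interaction with the noise is
  absorbed by the conjugate \<open>R\<close> of the Bregman divergence, evaluated along the partial sums \<open>B\<close> of
  the noise. Expanding \<open>R\<close> around the predictable point \<open>B (t - 1) + g' t\<close> rather than around
  \<open>B (t - 1)\<close> makes the second-order term the dual norm of \<open>g t\<close> instead of that of \<open>\<xi> t\<close>,
  which for a non-Euclidean norm could be larger.\<close>

lemma comida_player_regret:
  fixes S :: "'a::euclidean_space set" and z g g' :: "nat \<Rightarrow> 'w \<Rightarrow> 'a"
  assumes M: "prob_space M" and F: "filtration (space M) F" "\<And>t. subalgebra M (F t)"
    and S: "convex S" and N: "is_norm N" "is_norm N'"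
    and \<omega>: "distance_generating S N \<gamma> \<omega> d\<omega>"
    and \<gamma>: "\<gamma> > 0" and \<eta>: "\<eta> > 0" and \<rho>: "\<rho> > 0"
    and u1: "u1 \<in> S" "\<And>w. w \<in> space M \<Longrightarrow> z 1 w = u1"
    and z: "\<And>t. t \<in> {1..T} \<Longrightarrow> z t \<in> borel_measurable (F (t - 1))"
      "\<And>t. t \<in> {1..T} \<Longrightarrow> square_integrable M (z t)"
    and g: "\<And>t. t \<in> {1..T} \<Longrightarrow> g t \<in> borel_measurable (F t)"
      "\<And>t. t \<in> {1..T} \<Longrightarrow> square_integrable M (g t)"
    and g': "\<And>t. t \<in> {1..T} \<Longrightarrow> g' t \<in> borel_measurable (F (t - 1))"
      "\<And>t. t \<in> {1..T} \<Longrightarrow> square_integrable M (g' t)"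
    and unbiased: "\<And>t q. t \<in> {1..T} \<Longrightarrow> square_integrable M q \<Longrightarrow> q \<in> borel_measurable (F (t - 1)) \<Longrightarrow>
      (\<integral> w. q w \<bullet> g' t w \<partial>M) = (\<integral> w. q w \<bullet> g t w \<partial>M)"
    and min: "\<And>t w. t \<in> {1..T} \<Longrightarrow> w \<in> space M \<Longrightarrow>
      is_arg_min (\<lambda>v. v \<bullet> g t w + \<rho> * regularizer N' u1 v + 1 / \<eta> * bregman \<omega> d\<omega> v (z t w))
        (\<lambda>v. v \<in> S) (z (t + 1) w)"
    and u: "\<And>w. w \<in> space M \<Longrightarrow> u w \<in> S"
      "integrable M (\<lambda>w. bregman \<omega> d\<omega> (u w) u1)" "integrable M (\<lambda>w. (dual_norm N' (u w - u1))\<^sup>2)"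
  obtains U where "integrable M U"
    and "\<And>w. w \<in> space M \<Longrightarrow> (\<Sum>t=1..T. g' t w \<bullet> (z t w - u w)) \<le> U w"
    and "(\<integral> w. U w \<partial>M) = 2 * (\<integral> w. bregman \<omega> d\<omega> (u w) u1 \<partial>M) / \<eta>
      + real T * (\<rho> / 2 * (\<integral> w. (dual_norm N' (u w - u1))\<^sup>2 \<partial>M))
      - \<rho> / 2 * (\<Sum>t=1..T. \<integral> w. (dual_norm N' (z t w - u1))\<^sup>2 \<partial>M)
      + \<eta> / \<gamma> * (\<Sum>t=1..T. \<integral> w. (dual_norm N (g t w))\<^sup>2 \<partial>M)"
proof -
  interpret prob_space M by fact
  interpret filtration "space M" F by fact
  let ?D = "\<lambda>v. bregman \<omega> d\<omega> v u1"
  let ?H = "\<lambda>v. \<rho> * regularizer N' u1 v"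
  have c: "\<gamma> / (2 * \<eta>) > 0" using \<gamma> \<eta> by simp
  have \<psi>_convex: "?D ((1 - s) *\<^sub>R a + s *\<^sub>R b) / \<eta>
      \<le> (1 - s) * (?D a / \<eta>) + s * (?D b / \<eta>) - \<gamma> / (2 * \<eta>) * (s * (1 - s) * (N (a - b))\<^sup>2)"
    if "a \<in> S" "b \<in> S" "0 \<le> s" "s \<le> 1" for a b s
    using divide_right_mono[OF bregman_strongly_convex[OF S N(1) \<omega> that, of u1], of \<eta>] \<eta>
    by (simp add: diff_divide_distrib add_divide_distrib)
  have \<psi>_ge: "\<gamma> / (2 * \<eta>) * (N (v - u1))\<^sup>2 \<le> ?D v / \<eta>" if "v \<in> S" for v
    using divide_right_mono[OF bregman_ge[OF \<omega> that u1(1)], of \<eta>] \<eta> by simp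
  have \<psi>_u1: "?D u1 / \<eta> = 0" by (simp add: bregman_def)
  obtain R p K where R0: "R 0 = 0"
    and R_ge: "\<And>B v. v \<in> S \<Longrightarrow> - B \<bullet> (v - u1) \<le> ?D v / \<eta> + R B"
    and R_step: "\<And>C a b. R (C - b) \<le> R (C - a) + p C \<bullet> (a - b) + (dual_norm N b)\<^sup>2 / (4 * (\<gamma> / (2 * \<eta>)))"
    and K: "K \<ge> 0" "\<And>B C. norm (p B - p C) \<le> K * norm (B - C)"
    using strongly_convex_conjugate[where \<psi> = "\<lambda>v. ?D v / \<eta>", OF S u1(1) N(1) c \<psi>_convex \<psi>_ge \<psi>_u1]
    by blast
  define B where "B n w = (\<Sum>t=1..n. g' t w - g t w)" for n w
  \<comment> \<open>Collects everything that is paired with the noise of round \<open>t\<close> and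
    is already determined by the first \<open>t - 1\<close> rounds.\<close>
  define q where "q t w = z t w - u1 + p (B (t - 1) w + g' t w)" for t w
  \<comment> \<open>One divergence and half of \<open>\<eta> / \<gamma>\<close> come from the
    observed regret, the other ones from the conjugate. The last sum has mean zero.\<close>
  define U where "U w = 2 * (?D (u w) / \<eta>) + real T * ?H (u w) - (\<Sum>t=1..T. ?H (z t w))
    + \<eta> / \<gamma> * (\<Sum>t=1..T. (dual_norm N (g t w))\<^sup>2) + (\<Sum>t=1..T. q t w \<bullet> g' t w - q t w \<bullet> g t w)" for w

  have later: "f \<in> borel_measurable (F t)" if "f \<in> borel_measurable (F s)" "s \<le> t" for f :: "'w \<Rightarrow> 'a" and s t
  proof -
    have "subalgebra (F t) (F s)"
      using sets_F_mono[OF that(2)] by (simp add: subalgebra_def space_F)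
    then show ?thesis using that(1) by (rule measurable_from_subalg)
  qed
  have "B (t - 1) \<in> borel_measurable (F (t - 1))" if "t \<in> {1..T}" for t
    unfolding B_def using that
    by (intro borel_measurable_sum borel_measurable_diff)
      (auto intro: later[OF g'(1)] later[OF g(1)])
  then have C_meas: "(\<lambda>w. B (t - 1) w + g' t w) \<in> borel_measurable (F (t - 1))" if "t \<in> {1..T}" for t
    using that g'(1) by (intro borel_measurable_add)
  have "K-lipschitz_on UNIV p"
    using K by (intro lipschitz_onI) (auto simp: dist_norm)
  then have p_meas: "p \<in> borel_measurable borel"
    using borel_measurable_continuous_onI lipschitz_on_continuous_on by blast
  have q_meas: "q t \<in> borel_measurable (F (t - 1))" if "t \<in> {1..T}" for t
    unfolding q_def using that z(1) measurable_compose[OF C_meas p_meas]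
    by (intro borel_measurable_add borel_measurable_diff) auto
  have B_sq: "square_integrable M (B n)" if "n \<le> T" for n
    unfolding B_def using that g(2) g'(2)
    by (intro square_integrable_sum square_integrable_diff) auto
  have q_sq: "square_integrable M (q t)" if "t \<in> {1..T}" for t
  proof -
    have "t - 1 \<le> T" using that by auto
    then have "square_integrable M (\<lambda>w. B (t - 1) w + g' t w)"
      by (intro square_integrable_add B_sq g'(2) that)
    then have "square_integrable M (\<lambda>w. p (B (t - 1) w + g' t w))"
      using K by (rule square_integrable_lipschitz)
    with square_integrable_diff[OF z(2)[OF that] square_integrable_const]
    show ?thesis unfolding q_def by (rule square_integrable_add)
  qed
  have z_sq: "integrable M (\<lambda>w. (dual_norm N' (z t w - u1))\<^sup>2)" if "t \<in> {1..T}" for t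
    using that by (intro square_integrable_is_norm is_norm_dual_norm N square_integrable_diff
        square_integrable_const z)
  have g_sq: "integrable M (\<lambda>w. (dual_norm N (g t w))\<^sup>2)" if "t \<in> {1..T}" for t
    using that by (intro square_integrable_is_norm is_norm_dual_norm N g)
  have qg: "integrable M (\<lambda>w. q t w \<bullet> g t w)" "integrable M (\<lambda>w. q t w \<bullet> g' t w)" if "t \<in> {1..T}" for t
    using that by (auto intro!: square_integrable_inner q_sq g g')
  have U_integral: "has_bochner_integral M U (2 * ((\<integral> w. ?D (u w) \<partial>M) / \<eta>)
      + real T * (\<rho> * ((\<integral> w. (dual_norm N' (u w - u1))\<^sup>2 \<partial>M) / 2))
      - (\<Sum>t=1..T. \<rho> * ((\<integral> w. (dual_norm N' (z t w - u1))\<^sup>2 \<partial>M) / 2))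
      + \<eta> / \<gamma> * (\<Sum>t=1..T. \<integral> w. (dual_norm N (g t w))\<^sup>2 \<partial>M)
      + (\<Sum>t=1..T. (\<integral> w. q t w \<bullet> g' t w \<partial>M) - (\<integral> w. q t w \<bullet> g t w \<partial>M)))"
    unfolding U_def regularizer_def
    by (intro has_bochner_integral_add has_bochner_integral_diff has_bochner_integral_sum
        has_bochner_integral_mult_right has_bochner_integral_divide_zero
        has_bochner_integral_integrable u z_sq g_sq qg)
  show thesis
  proof
    show "integrable M U"
      using U_integral by (rule integrable.intros)
    have "(\<Sum>t=1..T. (\<integral> w. q t w \<bullet> g' t w \<partial>M) - (\<integral> w. q t w \<bullet> g t w \<partial>M)) = 0"
      by (intro sum.neutral ballI) (simp add: unbiased q_sq q_meas del: One_nat_def)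
    then show "(\<integral> w. U w \<partial>M) = 2 * (\<integral> w. ?D (u w) \<partial>M) / \<eta>
      + real T * (\<rho> / 2 * (\<integral> w. (dual_norm N' (u w - u1))\<^sup>2 \<partial>M))
      - \<rho> / 2 * (\<Sum>t=1..T. \<integral> w. (dual_norm N' (z t w - u1))\<^sup>2 \<partial>M)
      + \<eta> / \<gamma> * (\<Sum>t=1..T. \<integral> w. (dual_norm N (g t w))\<^sup>2 \<partial>M)"
      unfolding has_bochner_integral_integral_eq[OF U_integral] by (simp add: sum_distrib_left)
  next
    fix w assume w: "w \<in> space M"
    have noise: "R (B n w) \<le> (\<Sum>t=1..n. p (B (t - 1) w + g' t w) \<bullet> (g' t w - g t w))
        + \<eta> / (2 * \<gamma>) * (\<Sum>t=1..n. (dual_norm N (g t w))\<^sup>2)" for n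
    proof (induction n)
      case 0
      then show ?case by (simp add: B_def R0)
    next
      case (Suc n)
      have "R (B (Suc n) w) = R (B n w + g' (Suc n) w - g (Suc n) w)"
        by (simp add: B_def algebra_simps)
      also have "\<dots> \<le> R (B n w) + p (B n w + g' (Suc n) w) \<bullet> (g' (Suc n) w - g (Suc n) w)
          + \<eta> / (2 * \<gamma>) * (dual_norm N (g (Suc n) w))\<^sup>2"
        using R_step[of "B n w + g' (Suc n) w" "g (Suc n) w" "g' (Suc n) w"]
        by (simp add: mult.commute)
      finally show ?case
        using Suc by (simp add: distrib_left)
    qed
    have "(\<Sum>t=1..T. g t w \<bullet> (z t w - u w)) \<le> ?D (u w) / \<eta> + real T * ?H (u w)
        - (\<Sum>t=1..T. ?H (z t w)) + \<eta> / (2 * \<gamma>) * (\<Sum>t=1..T. (dual_norm N (g t w))\<^sup>2)"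
    proof -
      have "convex_on S ?H"
        using \<rho> by (intro convex_on_cmul convex_on_regularizer N S) auto
      moreover have "dual_norm N' 0 = 0"
        using is_norm_zero_iff[OF is_norm_dual_norm[OF N(2)], of 0] by simp
      ultimately show ?thesis
        using bregman_prox_regret[OF S N(1) \<omega> \<gamma> \<eta>, of ?H "\<lambda>t. z t w" "u w" T "\<lambda>t. g t w"]
          u(1)[OF w] u1 w \<rho> min by (simp add: regularizer_def)
    qed
    \<comment> \<open>Splitting \<open>z t - u\<close> at the fixed point \<open>u1\<close> isolates
      the part that depends on the future, \<open>u - u1\<close>; being the same in all rounds, it
      meets only the total noise \<open>B T\<close>, to which the conjugate inequality
      \<open>R_ge\<close> applies.\<close>
    moreover have "(\<Sum>t=1..T. g' t w \<bullet> (z t w - u w)) = (\<Sum>t=1..T. g t w \<bullet> (z t w - u w))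
        + (\<Sum>t=1..T. (z t w - u1) \<bullet> (g' t w - g t w)) - B T w \<bullet> (u w - u1)"
      unfolding B_def inner_sum_left sum.distrib[symmetric] sum_subtractf[symmetric]
      by (intro sum.cong refl) (simp add: inner_diff_left inner_diff_right inner_commute)
    moreover have "(\<Sum>t=1..T. q t w \<bullet> g' t w - q t w \<bullet> g t w) = (\<Sum>t=1..T. (z t w - u1) \<bullet> (g' t w - g t w))
        + (\<Sum>t=1..T. p (B (t - 1) w + g' t w) \<bullet> (g' t w - g t w))"
      unfolding q_def sum.distrib[symmetric]
      by (intro sum.cong refl) (simp add: inner_add_left inner_diff_left inner_diff_right)
    ultimately show "(\<Sum>t=1..T. g' t w \<bullet> (z t w - u w)) \<le> U w"
      unfolding U_def using noise[of T] R_ge[OF u(1)[OF w], of "B T w"]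
      by (simp add: field_simps)
  qed
qed

section \<open>Duality gap\<close>

lemma average_eq_convex_sum: "average T z = (\<Sum>t=1..T. (1 / real T) *\<^sub>R z t)"
  unfolding average_def by (simp add: scaleR_sum_right)

lemma convex_on_average_le:
  assumes "convex_on S h" "T \<ge> 1" "\<And>t. t \<in> {1..T} \<Longrightarrow> z t \<in> S"
  shows "h (average T z) \<le> (\<Sum>t=1..T. h (z t)) / real T"
proof -
  have "h (\<Sum>t=1..T. (1 / real T) *\<^sub>R z t) \<le> (\<Sum>t=1..T. 1 / real T * h (z t))"
    using assms by (intro convex_on_sum[OF _ _ assms(1)]) auto
  then show ?thesis
    by (simp add: average_eq_convex_sum sum_divide_distrib)
qed

text \<open>Jensen's inequality in each variable removes the averages; each summand is then split at
  the common value \<open>f (x t) (y t)\<close>, which cancels. The minus sign before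
  \<open>gy\<close> turns the maximizing player into a minimizing one.\<close>

lemma duality_gap_le_linearized_regret:
  assumes f: "convex_concave X Y f" and T: "T \<ge> 1"
    and x: "\<And>t. t \<in> {1..T} \<Longrightarrow> x t \<in> X" and y: "\<And>t. t \<in> {1..T} \<Longrightarrow> y t \<in> Y"
    and gx: "\<And>t. t \<in> {1..T} \<Longrightarrow> gx t \<in> partial_x X f (x t) (y t)"
    and gy: "\<And>t. t \<in> {1..T} \<Longrightarrow> gy t \<in> partial_y Y f (x t) (y t)"
    and u: "u \<in> X" and v: "v \<in> Y"
  shows "f (average T x) v - f u (average T y)
    \<le> ((\<Sum>t=1..T. gx t \<bullet> (x t - u)) + (\<Sum>t=1..T. - gy t \<bullet> (y t - v))) / real T"
proof -
  have "f (average T x) v \<le> (\<Sum>t=1..T. f (x t) v) / real T"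
    using f v x T unfolding convex_concave_def by (intro convex_on_average_le[of X]) auto
  moreover have "- f u (average T y) \<le> (\<Sum>t=1..T. - f u (y t)) / real T"
    using f u y T unfolding convex_concave_def concave_on_def
    by (intro convex_on_average_le[of Y "\<lambda>y. - f u y"]) auto
  ultimately have "f (average T x) v - f u (average T y)
      \<le> (\<Sum>t=1..T. f (x t) v) / real T + (\<Sum>t=1..T. - f u (y t)) / real T"
    by linarith
  also have "\<dots> = (\<Sum>t=1..T. f (x t) v - f u (y t)) / real T"
    by (simp add: add_divide_distrib[symmetric] sum.distrib[symmetric])
  also have "\<dots> \<le> (\<Sum>t=1..T. gx t \<bullet> (x t - u) + - gy t \<bullet> (y t - v)) / real T"
  proof (intro divide_right_mono sum_mono)
    fix t assume t: "t \<in> {1..T}"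
    have "f (x t) (y t) - f u (y t) \<le> gx t \<bullet> (x t - u)"
      using gx[OF t] u unfolding partial_x_def subdifferential_def by simp
    moreover have "f (x t) v - f (x t) (y t) \<le> - gy t \<bullet> (y t - v)"
      using gy[OF t] v unfolding partial_y_def subdifferential_def by force
    ultimately show "f (x t) v - f u (y t) \<le> gx t \<bullet> (x t - u) + - gy t \<bullet> (y t - v)"
      by linarith
  qed simp
  finally show ?thesis unfolding sum.distrib .
qed

text \<open>\<omega> is continuous only on \<open>S\<close>, hence the detour through the restricted
  space; as the second point \<open>v\<close> is fixed, its gradient is a constant vector.\<close>

lemma borel_measurable_bregman:
  fixes \<omega> :: "'a::euclidean_space \<Rightarrow> real"
  assumes \<omega>: "distance_generating S N \<gamma> \<omega> d\<omega>"
    and u: "u \<in> borel_measurable M" "\<And>w. w \<in> space M \<Longrightarrow> u w \<in> S"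
  shows "(\<lambda>w. bregman \<omega> d\<omega> (u w) v) \<in> borel_measurable M"
proof -
  have "continuous_on S \<omega>"
    using \<omega> unfolding distance_generating_def
    by (intro has_derivative_continuous_on[where f' = "\<lambda>u h. d\<omega> u \<bullet> h"]) blast
  moreover have "u \<in> M \<rightarrow>\<^sub>M restrict_space borel S"
    using u by (intro measurable_restrict_space2) auto
  ultimately have [measurable]: "(\<lambda>w. \<omega> (u w)) \<in> borel_measurable M"
    by (intro measurable_compose[OF _ borel_measurable_continuous_on_restrict])
  note [measurable] = u(1)
  show ?thesis unfolding bregman_def by measurable
qed

lemma (in finite_measure) bregman_prox_step_square_integrable:
  fixes S :: "'b::euclidean_space set"
  assumes S: "convex S" and N: "is_norm N" "is_norm N'"
    and \<omega>: "distance_generating S N \<gamma> \<omega> d\<omega>"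
    and \<gamma>: "\<gamma> > 0" and \<eta>: "\<eta> > 0" and \<rho>: "\<rho> > 0"
    and z: "square_integrable M z" "\<And>w. w \<in> space M \<Longrightarrow> z w \<in> S" and g: "square_integrable M g"
    and z': "z' \<in> borel_measurable M"
    and min: "\<And>w. w \<in> space M \<Longrightarrow>
      is_arg_min (\<lambda>v. v \<bullet> g w + \<rho> * regularizer N' u1 v + 1 / \<eta> * bregman \<omega> d\<omega> v (z w))
        (\<lambda>v. v \<in> S) (z' w)"
  shows "square_integrable M z'"
proof -
  have "square_integrable M (\<lambda>w. z' w - u1)"
  proof (rule square_integrableI_is_norm[OF is_norm_dual_norm[OF N(2)]])
    show "(\<lambda>w. z' w - u1) \<in> borel_measurable M"
      using z' by measurable
    show "integrable M (\<lambda>w. (dual_norm N' (z w - u1))\<^sup>2 + \<eta> / (\<gamma> * \<rho>) * (dual_norm N (g w))\<^sup>2)"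
      by (intro Bochner_Integration.integrable_add integrable_mult_right square_integrable_is_norm
          is_norm_dual_norm N square_integrable_diff square_integrable_const z g)
    show "AE w in M. (dual_norm N' (z' w - u1))\<^sup>2
        \<le> (dual_norm N' (z w - u1))\<^sup>2 + \<eta> / (\<gamma> * \<rho>) * (dual_norm N (g w))\<^sup>2"
      using bregman_prox_step_dist[OF S N \<omega> \<gamma> \<eta> \<rho> z(2) min] by (intro AE_I2)
  qed
  from square_integrable_add[OF this square_integrable_const[of u1]] show ?thesis
    by simp
qed

theorem theorem3p3:
  fixes X :: "(real ^ 'm) set" and Y :: "(real ^ 'n) set"
    and nx_X ny_X :: "real ^ 'm \<Rightarrow> real" and nx_Y ny_Y :: "real ^ 'n \<Rightarrow> real"
    and f :: "real ^ 'm \<Rightarrow> real ^ 'n \<Rightarrow> real"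
    and \<omega>x :: "real ^ 'm \<Rightarrow> real" and d\<omega>x :: "real ^ 'm \<Rightarrow> real ^ 'm"
    and \<omega>y :: "real ^ 'n \<Rightarrow> real" and d\<omega>y :: "real ^ 'n \<Rightarrow> real ^ 'n"
    and \<gamma>x \<gamma>y \<eta>x \<eta>y \<rho>x \<rho>y l L :: real
    and T :: nat
    and M :: "'w measure" and F :: "nat \<Rightarrow> 'w measure"
    and x1 :: "real ^ 'm" and y1 :: "real ^ 'n"
    and x gx gx' :: "nat \<Rightarrow> 'w \<Rightarrow> real ^ 'm"
    and y gy gy' :: "nat \<Rightarrow> 'w \<Rightarrow> real ^ 'n"
    and xstar :: "'w \<Rightarrow> real ^ 'm" and ystar :: "'w \<Rightarrow> real ^ 'n"
  assumes X: "convex X" and Y: "convex Y"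
    and norms: "is_norm nx_X" "is_norm nx_Y" "is_norm ny_X" "is_norm ny_Y"
    and f: "convex_concave X Y f"
    and l: "l > 0" "sub_bilinear nx_X nx_Y ny_X ny_Y X Y l f"
    and \<gamma>: "\<gamma>x > 0" "\<gamma>y > 0"
    and \<omega>x: "distance_generating X nx_X \<gamma>x \<omega>x d\<omega>x"
    and \<omega>y: "distance_generating Y ny_Y \<gamma>y \<omega>y d\<omega>y"
    and T: "T \<ge> 1" and L: "L > 0" and \<eta>: "\<eta>x > 0" "\<eta>y > 0"
    and \<rho>x: "\<rho>x = 2 * \<eta>y * L\<^sup>2 / \<gamma>y" and \<rho>y: "\<rho>y = 2 * \<eta>x * L\<^sup>2 / \<gamma>x"
    (* F t is the history of the first t rounds *)
    and M: "prob_space M"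
    and F: "filtration (space M) F" "\<And>t. subalgebra M (F t)"
    and iterates_measurable:
      "\<And>t. t \<in> {1..T} \<Longrightarrow> x t \<in> borel_measurable (F (t - 1))"
      "\<And>t. t \<in> {1..T} \<Longrightarrow> y t \<in> borel_measurable (F (t - 1))"
    (* gx t, gy t are the true subgradients, gx' t, gy' t the observed stochastic ones *)
    and subgradients:
      "\<And>t w. t \<in> {1..T} \<Longrightarrow> w \<in> space M \<Longrightarrow> gx t w \<in> partial_x X f (x t w) (y t w)"
      "\<And>t w. t \<in> {1..T} \<Longrightarrow> w \<in> space M \<Longrightarrow> gy t w \<in> partial_y Y f (x t w) (y t w)"
    and observations_measurable:
      "\<And>t. t \<in> {1..T} \<Longrightarrow> gx' t \<in> borel_measurable (F t)"
      "\<And>t. t \<in> {1..T} \<Longrightarrow> gy' t \<in> borel_measurable (F t)"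
    and unbiased:
      "\<And>t. t \<in> {1..T} \<Longrightarrow> AE w in M. vec_cond_exp M (F (t - 1)) (gx' t) w = gx t w"
      "\<And>t. t \<in> {1..T} \<Longrightarrow> AE w in M. vec_cond_exp M (F (t - 1)) (gy' t) w = gy t w"
    and second_moment:
      "\<And>t. t \<in> {1..T} \<Longrightarrow> AE w in M.
         nn_cond_exp M (F (t - 1)) (\<lambda>w. ennreal ((dual_norm nx_X (gx' t w))\<^sup>2)) w
           \<le> ennreal (L\<^sup>2 * ((dual_norm nx_Y (y t w - y1))\<^sup>2 + 1))"
      "\<And>t. t \<in> {1..T} \<Longrightarrow> AE w in M.
         nn_cond_exp M (F (t - 1)) (\<lambda>w. ennreal ((dual_norm ny_Y (gy' t w))\<^sup>2)) w
           \<le> ennreal (L\<^sup>2 * ((dual_norm ny_X (x t w - x1))\<^sup>2 + 1))"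
    and initial: "x1 \<in> X" "y1 \<in> Y"
      "\<And>w. w \<in> space M \<Longrightarrow> x 1 w = x1" "\<And>w. w \<in> space M \<Longrightarrow> y 1 w = y1"
    and comida_x: "\<And>t w. t \<in> {1..T} \<Longrightarrow> w \<in> space M \<Longrightarrow>
      is_arg_min
        (\<lambda>u. u \<bullet> gx' t w + \<rho>x * regularizer ny_X x1 u + 1 / \<eta>x * bregman \<omega>x d\<omega>x u (x t w))
        (\<lambda>u. u \<in> X) (x (t + 1) w)"
    and comida_y: "\<And>t w. t \<in> {1..T} \<Longrightarrow> w \<in> space M \<Longrightarrow>
      is_arg_max
        (\<lambda>v. v \<bullet> gy' t w - \<rho>y * regularizer nx_Y y1 v - 1 / \<eta>y * bregman \<omega>y d\<omega>y v (y t w))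
        (\<lambda>v. v \<in> Y) (y (t + 1) w)"
    and comparators: "xstar \<in> borel_measurable (F T)" "ystar \<in> borel_measurable (F T)"
      "\<And>w. w \<in> space M \<Longrightarrow> xstar w \<in> X" "\<And>w. w \<in> space M \<Longrightarrow> ystar w \<in> Y"
  shows "ext_expectation M
      (\<lambda>w. f (average T (\<lambda>t. x t w)) (ystar w) - f (xstar w) (average T (\<lambda>t. y t w)))
    \<le> 2 * ext_expectation M (\<lambda>w. bregman \<omega>y d\<omega>y (ystar w) y1) / ereal (\<eta>y * real T)
      + ereal (\<rho>y / 2) * ext_expectation M (\<lambda>w. (dual_norm nx_Y (ystar w - y1))\<^sup>2)
      + 2 * ext_expectation M (\<lambda>w. bregman \<omega>x d\<omega>x (xstar w) x1) / ereal (\<eta>x * real T)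
      + ereal (\<rho>x / 2) * ext_expectation M (\<lambda>w. (dual_norm ny_X (xstar w - x1))\<^sup>2)
      + ereal (L\<^sup>2 * (\<eta>y / \<gamma>y + \<eta>x / \<gamma>x))"
proof -
  interpret prob_space M by fact
  have sub: "finite_measure_subalgebra M (F t)" for t
    by (intro finite_measure_subalgebra.intro finite_measure_subalgebra_axioms.intro F(2) finite_measure_axioms)
  have pos: "\<rho>x > 0" "\<rho>y > 0" "real T > 0"
    using \<rho>x \<rho>y \<eta> \<gamma> L T by auto
  note dual = norms[THEN is_norm_dual_norm]
  let ?nx = "dual_norm nx_X" and ?nx' = "dual_norm nx_Y" and ?ny = "dual_norm ny_Y" and ?ny' = "dual_norm ny_X"
  \<comment> \<open>Negated gradients make the \<open>y\<close>-player a minimizer, so the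
    one-player regret bound serves both.\<close>
  have comida_y': "is_arg_min
      (\<lambda>v. v \<bullet> - gy' t w + \<rho>y * regularizer nx_Y y1 v + 1 / \<eta>y * bregman \<omega>y d\<omega>y v (y t w))
      (\<lambda>v. v \<in> Y) (y (t + 1) w)" if "t \<in> {1..T}" "w \<in> space M" for t w
    using comida_y[OF that] unfolding is_arg_max_def is_arg_min_def
    by (auto simp: algebra_simps)
  have x_in: "x t w \<in> X" and y_in: "y t w \<in> Y" if "t \<in> {1..T}" "w \<in> space M" for t w
  proof -
    have "t = 1 \<or> t = (t - 1) + 1 \<and> t - 1 \<in> {1..T}"
      using that(1) by auto
    then consider "t = 1" | s where "t = s + 1" "s \<in> {1..T}"
      by blast
    then have "x t w \<in> X \<and> y t w \<in> Y"
    proof cases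
      case 1
      then show ?thesis using initial that(2) by simp
    next
      case (2 s)
      then show ?thesis
        using comida_x[OF 2(2) that(2)] comida_y[OF 2(2) that(2)]
        by (auto simp: is_arg_min_def is_arg_max_def)
    qed
    then show "x t w \<in> X" "y t w \<in> Y" by auto
  qed
  note from_F = measurable_from_subalg[OF F(2)]
  have x_meas: "x t \<in> borel_measurable M" and y_meas: "y t \<in> borel_measurable M" if "t \<in> {1..T}" for t
    using iterates_measurable[OF that] by (auto intro: from_F)
  have obs_meas: "gx' t \<in> borel_measurable M" "gy' t \<in> borel_measurable M" if "t \<in> {1..T}" for t
    using observations_measurable[OF that] by (auto intro: from_F)

  \<comment> \<open>Second moments of observed gradients and iterates\<close>
  have noise_x: "square_integrable M (gx' t)"
      "(\<integral> w. (?nx (gx' t w))\<^sup>2 \<partial>M) \<le> L\<^sup>2 * ((\<integral> w. (?nx' (y t w - y1))\<^sup>2 \<partial>M) + 1)"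
    if t: "t \<in> {1..T}" and y_sq: "square_integrable M (y t)" for t
  proof -
    interpret Ft: finite_measure_subalgebra M "F (t - 1)" by (rule sub)
    have int: "integrable M (\<lambda>w. (?nx' (y t w - y1))\<^sup>2)"
      by (intro square_integrable_is_norm dual square_integrable_diff square_integrable_const y_sq)
    then have k: "integrable M (\<lambda>w. L\<^sup>2 * ((?nx' (y t w - y1))\<^sup>2 + 1))"
      by simp
    note bound = Ft.nn_cond_exp_square_bound[OF dual(1) obs_meas(1)[OF t] k _ second_moment(1)[OF t]]
    show "square_integrable M (gx' t)" by (rule bound) simp
    show "(\<integral> w. (?nx (gx' t w))\<^sup>2 \<partial>M) \<le> L\<^sup>2 * ((\<integral> w. (?nx' (y t w - y1))\<^sup>2 \<partial>M) + 1)"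
      using bound(2) int by (simp add: prob_space)
  qed
  have noise_y: "square_integrable M (gy' t)"
      "(\<integral> w. (?ny (gy' t w))\<^sup>2 \<partial>M) \<le> L\<^sup>2 * ((\<integral> w. (?ny' (x t w - x1))\<^sup>2 \<partial>M) + 1)"
    if t: "t \<in> {1..T}" and x_sq: "square_integrable M (x t)" for t
  proof -
    interpret Ft: finite_measure_subalgebra M "F (t - 1)" by (rule sub)
    have int: "integrable M (\<lambda>w. (?ny' (x t w - x1))\<^sup>2)"
      by (intro square_integrable_is_norm dual square_integrable_diff square_integrable_const x_sq)
    then have k: "integrable M (\<lambda>w. L\<^sup>2 * ((?ny' (x t w - x1))\<^sup>2 + 1))"
      by simp
    note bound = Ft.nn_cond_exp_square_bound[OF dual(4) obs_meas(2)[OF t] k _ second_moment(2)[OF t]]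
    show "square_integrable M (gy' t)" by (rule bound) simp
    show "(\<integral> w. (?ny (gy' t w))\<^sup>2 \<partial>M) \<le> L\<^sup>2 * ((\<integral> w. (?ny' (x t w - x1))\<^sup>2 \<partial>M) + 1)"
      using bound(2) int by (simp add: prob_space)
  qed

  \<comment> \<open>The moment bounds are crossed: \<open>y s\<close> controls \<open>gx' s\<close>,
    which together with \<open>x s\<close> controls \<open>x (s + 1)\<close>, and symmetrically. The
    range stops at \<open>T\<close> because measurability is given only for these iterates.\<close>
  have "t \<in> {1..T} \<longrightarrow> square_integrable M (x t) \<and> square_integrable M (y t)" for t
  proof (induction t)
    case (Suc s)
    show ?case
    proof (cases "s = 0")
      case True
      have "square_integrable M (x 1)" "square_integrable M (y 1)"
        using T initial(3,4) x_meas[of 1] y_meas[of 1]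
        by (auto intro!: square_integrableI_bound[where k = "\<lambda>_. (norm x1)\<^sup>2 + (norm y1)\<^sup>2"] AE_I2)
      then show ?thesis using True by simp
    next
      case False
      show ?thesis
      proof
        assume Suc_s: "Suc s \<in> {1..T}"
        with False have s: "s \<in> {1..T}" by auto
        with Suc have sq: "square_integrable M (x s)" "square_integrable M (y s)" by auto
        have "square_integrable M (x (s + 1))"
          using s Suc_s
          by (intro bregman_prox_step_square_integrable[OF X norms(1,3) \<omega>x \<gamma>(1) \<eta>(1) pos(1) sq(1) x_in
                noise_x(1)[OF s sq(2)] x_meas comida_x]) auto
        moreover have "square_integrable M (y (s + 1))"
          using s Suc_s
          by (intro bregman_prox_step_square_integrable[OF Y norms(4,2) \<omega>y \<gamma>(2) \<eta>(2) pos(2) sq(2) y_in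
                square_integrable_minus[OF noise_y(1)[OF s sq(1)]] y_meas comida_y']) auto
        ultimately show "square_integrable M (x (Suc s)) \<and> square_integrable M (y (Suc s))" by simp
      qed
    qed
  qed simp
  then have x_sq: "square_integrable M (x t)" and y_sq: "square_integrable M (y t)" if "t \<in> {1..T}" for t
    using that by auto

  \<comment> \<open>The subgradients \<open>gx t\<close> and \<open>gy t\<close> carry no
    measurability assumption. Their conditional-expectation versions are measurable for the past and
    agree with them almost everywhere; sub-bilinearity transfers the square integrability of the
    iterates to them.\<close>
  let ?gx = "\<lambda>t. vec_cond_exp M (F (t - 1)) (gx' t)" and ?gy = "\<lambda>t. vec_cond_exp M (F (t - 1)) (gy' t)"
  have gx_sq: "square_integrable M (?gx t)" if t: "t \<in> {1..T}" for t
  proof (rule square_integrableI_is_norm[OF dual(1)])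
    show "?gx t \<in> borel_measurable M"
      by (rule from_F[OF borel_measurable_vec_cond_exp])
    show "integrable M (\<lambda>w. l\<^sup>2 * ((?nx' (y t w))\<^sup>2 + 1))"
      using square_integrable_is_norm[OF dual(2) y_sq[OF t]] by simp
    show "AE w in M. (?nx (?gx t w))\<^sup>2 \<le> l\<^sup>2 * ((?nx' (y t w))\<^sup>2 + 1)"
      using unbiased(1)[OF t] AE_space
    proof eventually_elim
      case (elim w)
      show ?case
        using l(2) x_in[OF t elim(2)] y_in[OF t elim(2)] subgradients(1)[OF t elim(2)]
        unfolding elim(1) sub_bilinear_def by blast
    qed
  qed
  have gy_sq: "square_integrable M (?gy t)" if t: "t \<in> {1..T}" for t
  proof (rule square_integrableI_is_norm[OF dual(4)])
    show "?gy t \<in> borel_measurable M"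
      by (rule from_F[OF borel_measurable_vec_cond_exp])
    show "integrable M (\<lambda>w. l\<^sup>2 * ((?ny' (x t w))\<^sup>2 + 1))"
      using square_integrable_is_norm[OF dual(3) x_sq[OF t]] by simp
    show "AE w in M. (?ny (?gy t w))\<^sup>2 \<le> l\<^sup>2 * ((?ny' (x t w))\<^sup>2 + 1)"
      using unbiased(2)[OF t] AE_space
    proof eventually_elim
      case (elim w)
      show ?case
        using l(2) x_in[OF t elim(2)] y_in[OF t elim(2)] subgradients(2)[OF t elim(2)]
        unfolding elim(1) sub_bilinear_def by blast
    qed
  qed

  \<comment> \<open>Comparators and the expected gap\<close>
  let ?Dx = "\<lambda>w. bregman \<omega>x d\<omega>x (xstar w) x1" and ?Dy = "\<lambda>w. bregman \<omega>y d\<omega>y (ystar w) y1"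
  let ?Hx = "\<lambda>w. (?ny' (xstar w - x1))\<^sup>2" and ?Hy = "\<lambda>w. (?nx' (ystar w - y1))\<^sup>2"
  let ?G = "\<lambda>w. f (average T (\<lambda>t. x t w)) (ystar w) - f (xstar w) (average T (\<lambda>t. y t w))"
  have star_meas: "xstar \<in> borel_measurable M" "ystar \<in> borel_measurable M"
    using comparators(1,2) by (auto intro: from_F)
  have norm_meas: "(\<lambda>w. (N (v w - c))\<^sup>2) \<in> borel_measurable M"
    if "is_norm N" "v \<in> borel_measurable M" for N :: "real ^ 'k \<Rightarrow> real" and v c
  proof -
    have [measurable]: "N \<in> borel_measurable borel"
      using borel_measurable_continuous_onI[OF is_norm_continuous_on[OF that(1)]] .
    note [measurable] = that(2)
    show ?thesis by measurable
  qed
  have D_nonneg: "0 \<le> bregman \<omega> d\<omega> u v"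
    if "distance_generating S N \<gamma> \<omega> d\<omega>" "\<gamma> > 0" "u \<in> S" "v \<in> S"
    for S N \<gamma> and \<omega> :: "real ^ 'k \<Rightarrow> real" and d\<omega> u v
  proof -
    have "0 \<le> \<gamma> / 2 * (N (u - v))\<^sup>2" using that(2) by simp
    also have "\<dots> \<le> bregman \<omega> d\<omega> u v" by (rule bregman_ge[OF that(1,3,4)])
    finally show ?thesis .
  qed
  show ?thesis
  \<comment> \<open>If one of the four fails to be integrable, its summand is infinite, since all
    coefficients are positive, and the right-hand side is then infinite.\<close>
  proof (cases "integrable M ?Dx \<and> integrable M ?Dy \<and> integrable M ?Hx \<and> integrable M ?Hy")
    case False
    moreover have "ext_expectation M ?Dx = \<infinity>" if "\<not> integrable M ?Dx"
      using that comparators(3) initial(1)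
      by (intro ext_expectation_not_integrable borel_measurable_bregman[OF \<omega>x star_meas(1)] AE_I2
          D_nonneg[OF \<omega>x \<gamma>(1)]) auto
    moreover have "ext_expectation M ?Dy = \<infinity>" if "\<not> integrable M ?Dy"
      using that comparators(4) initial(2)
      by (intro ext_expectation_not_integrable borel_measurable_bregman[OF \<omega>y star_meas(2)] AE_I2
          D_nonneg[OF \<omega>y \<gamma>(2)]) auto
    moreover have "ext_expectation M ?Hx = \<infinity>" if "\<not> integrable M ?Hx"
      using that by (intro ext_expectation_not_integrable norm_meas dual star_meas AE_I2) auto
    moreover have "ext_expectation M ?Hy = \<infinity>" if "\<not> integrable M ?Hy"
      using that by (intro ext_expectation_not_integrable norm_meas dual star_meas AE_I2) auto
    ultimately show ?thesis
      using pos \<eta> by auto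
  next
    case True
    then have int: "integrable M ?Dx" "integrable M ?Dy" "integrable M ?Hx" "integrable M ?Hy"
      by auto
    have unbiased_x: "(\<integral> w. q w \<bullet> ?gx t w \<partial>M) = (\<integral> w. q w \<bullet> gx' t w \<partial>M)"
      if "t \<in> {1..T}" "square_integrable M q" "q \<in> borel_measurable (F (t - 1))" for t q
      using finite_measure_subalgebra.integral_inner_vec_cond_exp[OF sub noise_x(1)] y_sq that by blast
    have unbiased_y: "(\<integral> w. q w \<bullet> - ?gy t w \<partial>M) = (\<integral> w. q w \<bullet> - gy' t w \<partial>M)"
      if "t \<in> {1..T}" "square_integrable M q" "q \<in> borel_measurable (F (t - 1))" for t q
      using finite_measure_subalgebra.integral_inner_vec_cond_exp[OF sub noise_y(1)] x_sq that by simp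
    obtain Ux where Ux: "integrable M Ux"
      "\<And>w. w \<in> space M \<Longrightarrow> (\<Sum>t=1..T. ?gx t w \<bullet> (x t w - xstar w)) \<le> Ux w"
      "(\<integral> w. Ux w \<partial>M) = 2 * (\<integral> w. ?Dx w \<partial>M) / \<eta>x + real T * (\<rho>x / 2 * (\<integral> w. ?Hx w \<partial>M))
        - \<rho>x / 2 * (\<Sum>t=1..T. \<integral> w. (?ny' (x t w - x1))\<^sup>2 \<partial>M)
        + \<eta>x / \<gamma>x * (\<Sum>t=1..T. \<integral> w. (?nx (gx' t w))\<^sup>2 \<partial>M)"
      by (rule comida_player_regret[where T = T and z = x and g = gx' and g' = ?gx and u = xstar,
            OF M F X norms(1,3) \<omega>x \<gamma>(1) \<eta>(1) pos(1) initial(1,3) iterates_measurable(1) x_sq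
            observations_measurable(1) noise_x(1)[OF _ y_sq] borel_measurable_vec_cond_exp gx_sq
            unbiased_x comida_x comparators(3) int(1,3)]) (assumption | rule that)+
    obtain Uy where Uy: "integrable M Uy"
      "\<And>w. w \<in> space M \<Longrightarrow> (\<Sum>t=1..T. - ?gy t w \<bullet> (y t w - ystar w)) \<le> Uy w"
      "(\<integral> w. Uy w \<partial>M) = 2 * (\<integral> w. ?Dy w \<partial>M) / \<eta>y + real T * (\<rho>y / 2 * (\<integral> w. ?Hy w \<partial>M))
        - \<rho>y / 2 * (\<Sum>t=1..T. \<integral> w. (?nx' (y t w - y1))\<^sup>2 \<partial>M)
        + \<eta>y / \<gamma>y * (\<Sum>t=1..T. \<integral> w. (?ny (- gy' t w))\<^sup>2 \<partial>M)"
      by (rule comida_player_regret[where T = T and z = y and g = "\<lambda>t w. - gy' t w" and g' = "\<lambda>t w. - ?gy t w"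
            and u = ystar,
            OF M F Y norms(4,2) \<omega>y \<gamma>(2) \<eta>(2) pos(2) initial(2,4) iterates_measurable(2) y_sq
            borel_measurable_uminus[OF observations_measurable(2)]
            square_integrable_minus[OF noise_y(1)[OF _ x_sq]]
            borel_measurable_uminus[OF borel_measurable_vec_cond_exp] square_integrable_minus[OF gy_sq]
            unbiased_y comida_y' comparators(4) int(2,4)]) (assumption | rule that)+
    \<comment> \<open>Finitely many rounds allow a common null set, so the pathwise gap bound may
      return to the true subgradients.\<close>
    have "AE w in M. \<forall>t\<in>{1..T}. ?gx t w = gx t w \<and> ?gy t w = gy t w"
      using unbiased by (intro AE_finite_allI) auto
    then have "AE w in M. ?G w \<le> (Ux w + Uy w) / real T"
      using AE_space
    proof eventually_elim
      case (elim w)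
      have "?G w \<le> ((\<Sum>t=1..T. gx t w \<bullet> (x t w - xstar w))
          + (\<Sum>t=1..T. - gy t w \<bullet> (y t w - ystar w))) / real T"
        using elim(2) by (intro duality_gap_le_linearized_regret[OF f T] x_in y_in subgradients comparators)
      also have "\<dots> = ((\<Sum>t=1..T. ?gx t w \<bullet> (x t w - xstar w))
          + (\<Sum>t=1..T. - ?gy t w \<bullet> (y t w - ystar w))) / real T"
        using elim(1) by simp
      also have "\<dots> \<le> (Ux w + Uy w) / real T"
        using Ux(2)[OF elim(2)] Uy(2)[OF elim(2)] by (intro divide_right_mono add_mono) auto
      finally show ?case .
    qed
    then have "ext_expectation M ?G \<le> ext_expectation M (\<lambda>w. (Ux w + Uy w) / real T)"
      by (rule ext_expectation_mono_AE)
    also have "\<dots> = ereal (((\<integral> w. Ux w \<partial>M) + (\<integral> w. Uy w \<partial>M)) / real T)"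
      using Ux(1) Uy(1) by (subst ext_expectation_eq_integral) auto
    also have "\<dots> \<le> ereal (2 * (\<integral> w. ?Dy w \<partial>M) / (\<eta>y * real T) + \<rho>y / 2 * (\<integral> w. ?Hy w \<partial>M)
        + 2 * (\<integral> w. ?Dx w \<partial>M) / (\<eta>x * real T) + \<rho>x / 2 * (\<integral> w. ?Hx w \<partial>M)
        + L\<^sup>2 * (\<eta>y / \<gamma>y + \<eta>x / \<gamma>x))"
    proof -
      let ?X = "\<Sum>t=1..T. \<integral> w. (?ny' (x t w - x1))\<^sup>2 \<partial>M"
      let ?Y = "\<Sum>t=1..T. \<integral> w. (?nx' (y t w - y1))\<^sup>2 \<partial>M"
      have "(\<Sum>t=1..T. \<integral> w. (?nx (gx' t w))\<^sup>2 \<partial>M)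
          \<le> (\<Sum>t=1..T. L\<^sup>2 * ((\<integral> w. (?nx' (y t w - y1))\<^sup>2 \<partial>M) + 1))"
        by (intro sum_mono noise_x y_sq)
      also have "\<dots> = L\<^sup>2 * (?Y + real T)"
        by (simp add: sum_distrib_left[symmetric] sum.distrib)
      finally have "\<eta>x / \<gamma>x * (\<Sum>t=1..T. \<integral> w. (?nx (gx' t w))\<^sup>2 \<partial>M) \<le> \<eta>x / \<gamma>x * (L\<^sup>2 * (?Y + real T))"
        using \<eta> \<gamma> by (intro mult_left_mono) auto
      \<comment> \<open>The choice of \<open>\<rho>y\<close> amounts to
        \<open>\<eta>x / \<gamma>x * L\<^sup>2 = \<rho>y / 2\<close>: the \<open>?Y\<close> term
        cancels the negative regularizer sum in the integral of \<open>Uy\<close>, and the rest is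
        the \<open>x\<close>-part of the final constant, times \<open>T\<close>.\<close>
      also have "\<dots> = \<rho>y / 2 * ?Y + real T * (L\<^sup>2 * (\<eta>x / \<gamma>x))"
        unfolding \<rho>y using \<gamma> by (simp add: field_simps)
      finally have X_le: "\<eta>x / \<gamma>x * (\<Sum>t=1..T. \<integral> w. (?nx (gx' t w))\<^sup>2 \<partial>M) \<le> \<dots>" .
      have "(\<Sum>t=1..T. \<integral> w. (?ny (- gy' t w))\<^sup>2 \<partial>M)
          \<le> (\<Sum>t=1..T. L\<^sup>2 * ((\<integral> w. (?ny' (x t w - x1))\<^sup>2 \<partial>M) + 1))"
        unfolding is_norm_minus[OF dual(4)] by (intro sum_mono noise_y x_sq)
      also have "\<dots> = L\<^sup>2 * (?X + real T)"
        by (simp add: sum_distrib_left[symmetric] sum.distrib)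
      finally have "\<eta>y / \<gamma>y * (\<Sum>t=1..T. \<integral> w. (?ny (- gy' t w))\<^sup>2 \<partial>M) \<le> \<eta>y / \<gamma>y * (L\<^sup>2 * (?X + real T))"
        using \<eta> \<gamma> by (intro mult_left_mono) auto
      also have "\<dots> = \<rho>x / 2 * ?X + real T * (L\<^sup>2 * (\<eta>y / \<gamma>y))"
        unfolding \<rho>x using \<gamma> by (simp add: field_simps)
      finally have Y_le: "\<eta>y / \<gamma>y * (\<Sum>t=1..T. \<integral> w. (?ny (- gy' t w))\<^sup>2 \<partial>M) \<le> \<dots>" .
      have "(\<integral> w. Ux w \<partial>M) + (\<integral> w. Uy w \<partial>M)
          \<le> 2 * (\<integral> w. ?Dy w \<partial>M) / \<eta>y + real T * (\<rho>y / 2 * (\<integral> w. ?Hy w \<partial>M))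
          + 2 * (\<integral> w. ?Dx w \<partial>M) / \<eta>x + real T * (\<rho>x / 2 * (\<integral> w. ?Hx w \<partial>M))
          + real T * (L\<^sup>2 * (\<eta>y / \<gamma>y)) + real T * (L\<^sup>2 * (\<eta>x / \<gamma>x))"
        using X_le Y_le unfolding Ux(3) Uy(3) by linarith
      from divide_right_mono[OF this, of "real T"] show ?thesis
        using pos(3) by (simp add: add_divide_distrib distrib_left)
    qed
    also have "\<dots> = 2 * ext_expectation M ?Dy / ereal (\<eta>y * real T)
        + ereal (\<rho>y / 2) * ext_expectation M ?Hy
        + 2 * ext_expectation M ?Dx / ereal (\<eta>x * real T)
        + ereal (\<rho>x / 2) * ext_expectation M ?Hx
        + ereal (L\<^sup>2 * (\<eta>y / \<gamma>y + \<eta>x / \<gamma>x))"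
      using pos(3) \<eta> by (simp add: int[THEN ext_expectation_eq_integral] numeral_eq_ereal)
    finally show ?thesis .
  qed
qed

end
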